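(* Let $G$ be a finite group and let $K$ be a splitting field of $G$ (of arbitrary characteristic $p\ge 0$). Let $t$ be the number of (indecomposable) blocks of $KG$ and let $d_i$ $(1\le i\le t)$ be the dimension over $K$ of the $i$-th block of $KG$. Then $V_G\cap Z(KG)$ is a Mathieu subspace of $KG$ if and only if for all $\emptyset\neq J\subseteq\{1,2,\dots,t\}$, both the numerator and the denominator of the rational number $$\frac{1}{|G|}\sum_{i\in J} d_i$$ in reduced form are co-prime to $p$ (where, if $p=0$, an integer is regarded as co-prime to $p$ when it is nonzero).
   Context: $KG$ is the group algebra, $Z(KG)$ its center, and $V_G$ the $K$-subspace of $KG$ spanned by all $g\in G$ with $g\neq 1$ (the elements whose coefficient at $1_G$ is zero). The blocks of $KG$ are the indecomposable two-sided ideal direct summands $f_iKG$, where $f_1,\dots,f_t$ are the primitive idempotents of $Z(KG)$. A $K$-subspace $V$ of a unital $K$-algebra $\mathcal A$ is a Mathieu subspace of $\mathcal A$ if for all $a,b,c\in\mathcal A$ with $b^m\in V$ for all $m\ge 1$, there exists $N\in\mathbb N$ (depending on $a,b,c$) such that $ab^mc\in V$ for all $m\ge N$. $K$ is a splitting field of $G$ if every irreducible $KG$-module is absolutely irreducible. *)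

theory Defs
  imports
    "HOL-Library.Poly_Mapping"
    "HOL-Library.Cardinality"
    "HOL-Algebra.Algebraic_Closure_Type"
    "Jordan_Normal_Form.Matrix"
begin

text \<open>
  A group is a type of class \<open>group_add\<close>, which is not assumed to be commutative; it is written
  additively, so \<open>0\<close> is the neutral element of G. The convolution product of
  \<open>HOL-Library.Poly_Mapping\<close> makes \<open>'g \<Rightarrow>\<^sub>0 'k\<close> the group algebra KG:
  the group element \<open>g\<close> is \<open>Poly_Mapping.single g 1\<close>, the coefficient of \<open>x\<close> at \<open>g\<close> is
  \<open>Poly_Mapping.lookup x g\<close>, and a scalar \<open>c\<close> is \<open>Poly_Mapping.single 0 c\<close>.
\<close>

definition galg_scale :: "'k::field \<Rightarrow> ('g::group_add \<Rightarrow>\<^sub>0 'k) \<Rightarrow> ('g \<Rightarrow>\<^sub>0 'k)" where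
  "galg_scale c x = Poly_Mapping.single 0 c * x"

interpretation KG: vector_space "galg_scale :: 'k::field \<Rightarrow> ('g::group_add \<Rightarrow>\<^sub>0 'k) \<Rightarrow> _"
proof
  fix a b :: 'k and x y :: "'g \<Rightarrow>\<^sub>0 'k"
  show "galg_scale a (x + y) = galg_scale a x + galg_scale a y"
    by (simp add: galg_scale_def distrib_left)
  show "galg_scale (a + b) x = galg_scale a x + galg_scale b x"
    by (simp add: galg_scale_def single_add distrib_right)
  show "galg_scale a (galg_scale b x) = galg_scale (a * b) x"
    by (simp add: galg_scale_def mult_single flip: mult.assoc)
  show "galg_scale 1 x = x"
    by (simp add: galg_scale_def)
qed

definition ring_center :: "'a::ring_1 set" where
  "ring_center = {z. \<forall>x. z * x = x * z}"

definition V_G :: "('g::group_add \<Rightarrow>\<^sub>0 'k::field) set" where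
  "V_G = KG.span {Poly_Mapping.single g 1 | g. g \<noteq> 0}"

text \<open>\<open>scale\<close> is the scalar multiplication of the unital algebra \<open>'a\<close> over \<open>'k\<close>.\<close>

definition mathieu_subspace :: "('k::field \<Rightarrow> 'a::ring_1 \<Rightarrow> 'a) \<Rightarrow> 'a set \<Rightarrow> bool" where
  "mathieu_subspace scale V \<longleftrightarrow>
     module.subspace scale V \<and>
     (\<forall>a b c. (\<forall>m\<ge>1. b ^ m \<in> V) \<longrightarrow> (\<exists>N::nat. \<forall>m\<ge>N. a * b ^ m * c \<in> V))"

definition primitive_central_idempotent :: "'a::ring_1 \<Rightarrow> bool" where
  "primitive_central_idempotent f \<longleftrightarrow>
     f \<in> ring_center \<and> f \<noteq> 0 \<and> f * f = f \<and>
     (\<forall>u\<in>ring_center. \<forall>v\<in>ring_center.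
        u * u = u \<and> v * v = v \<and> u * v = 0 \<and> f = u + v \<longrightarrow> u = 0 \<or> v = 0)"

definition blocks :: "('g::group_add \<Rightarrow>\<^sub>0 'k::field) set set" where
  "blocks = {range (\<lambda>x. f * x) | f. primitive_central_idempotent f}"

text \<open>
  A KG-module of dimension \<open>n\<close> is given, after a choice of basis, by the action of G on the column
  space \<open>carrier_vec n\<close>. For finite G every irreducible KG-module has finite dimension, so these
  are all of them. Submodules are the G-invariant subspaces.
\<close>

definition matrix_rep :: "nat \<Rightarrow> ('g::group_add \<Rightarrow> 'k::field mat) \<Rightarrow> bool" where
  "matrix_rep n \<rho> \<longleftrightarrow>
     (\<forall>g. \<rho> g \<in> carrier_mat n n) \<and> \<rho> 0 = 1\<^sub>m n \<and> (\<forall>g h. \<rho> (g + h) = \<rho> g * \<rho> h)"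

definition submodule_rep ::
  "nat \<Rightarrow> ('g::group_add \<Rightarrow> 'k::field mat) \<Rightarrow> 'k vec set \<Rightarrow> bool" where
  "submodule_rep n \<rho> W \<longleftrightarrow>
     W \<subseteq> carrier_vec n \<and> 0\<^sub>v n \<in> W \<and> (\<forall>v\<in>W. \<forall>w\<in>W. v + w \<in> W) \<and>
     (\<forall>c. \<forall>v\<in>W. c \<cdot>\<^sub>v v \<in> W) \<and> (\<forall>g. \<forall>v\<in>W. \<rho> g *\<^sub>v v \<in> W)"

definition irreducible_rep :: "nat \<Rightarrow> ('g::group_add \<Rightarrow> 'k::field mat) \<Rightarrow> bool" where
  "irreducible_rep n \<rho> \<longleftrightarrow>
     matrix_rep n \<rho> \<and> n > 0 \<and>
     (\<forall>W. submodule_rep n \<rho> W \<longrightarrow> W = {0\<^sub>v n} \<or> W = carrier_vec n)"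

text \<open>
  Absolute irreducibility is irreducibility after extending scalars to the algebraic closure;
  irreducibility over every extension field, which cannot be quantified over inside a formula,
  is formally stronger and well known to be equivalent.
\<close>

definition absolutely_irreducible_rep :: "nat \<Rightarrow> ('g::group_add \<Rightarrow> 'k::field mat) \<Rightarrow> bool" where
  "absolutely_irreducible_rep n \<rho> \<longleftrightarrow>
     matrix_rep n \<rho> \<and> irreducible_rep n (\<lambda>g. map_mat to_ac (\<rho> g))"

definition is_splitting_field :: "'k::field itself \<Rightarrow> 'g::group_add itself \<Rightarrow> bool" where
  "is_splitting_field _ _ \<longleftrightarrow>
     (\<forall>n (\<rho> :: 'g \<Rightarrow> 'k mat). irreducible_rep n \<rho> \<longrightarrow> absolutely_irreducible_rep n \<rho>)"

definition coprime_to_char :: "nat \<Rightarrow> int \<Rightarrow> bool" where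
  "coprime_to_char p a \<longleftrightarrow> (if p = 0 then a \<noteq> 0 else coprime a (int p))"

end

theory Submission
  imports Defs "HOL-Algebra.Group_Action" "HOL-Algebra.Sylow"
    "HOL-Algebra.Elementary_Groups" "HOL-Algebra.Multiplicative_Group"
begin

text \<open>
  The coefficient of an element of \<open>KG\<close> at the neutral element is a trace function, and \<open>V_G\<close> is its
  kernel. A subspace of the centre that contains a nonzero idempotent \<open>e\<close> and lies in \<open>V_G\<close> cannot be
  a Mathieu subspace of \<open>KG\<close>, because all \<open>g e\<close> would have to lie in \<open>V_G\<close> too, which makes every
  coefficient of \<open>e\<close> vanish. If there is no such idempotent, Fitting's lemma shows that an element
  with all positive powers in the subspace is nilpotent, and the Mathieu property is immediate
  (\<open>mathieu_center_iff_no_traceless_idempotent\<close>). The central idempotents are the sums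
  \<open>\<Sum>i\<in>J. f\<^sub>i\<close> of primitive ones, so the question is for which \<open>J\<close> the coefficient of this sum at the
  neutral element vanishes.

  Let \<open>p > 0\<close> be the characteristic of \<open>K\<close>. The bridge to block dimensions is
  \<open>dim_idempotent_ideal\<close>: if \<open>|G| = p\<^sup>a m\<close> with \<open>p\<close> not dividing
  \<open>m\<close>, then \<open>dim (e KG) = p\<^sup>a r\<close> for an integer \<open>r\<close>, and \<open>r = m e(1)\<close> holds in \<open>K\<close> for the coefficient
  \<open>e(1)\<close> of the idempotent \<open>e\<close> at the neutral element. Hence \<open>(\<Sum>i\<in>J. d\<^sub>i) / |G| = (\<Sum>i\<in>J. r\<^sub>i) / m\<close> always
  has a denominator prime to \<open>p\<close>, and its numerator is prime to \<open>p\<close> exactly if the coefficient of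
  \<open>\<Sum>i\<in>J. f\<^sub>i\<close> does not vanish.

  This could be derived by lifting idempotents to characteristic 0. The proof given here stays over
  \<open>K\<close>. Let \<open>H\<close> be a Sylow \<open>p\<close>-subgroup. Since \<open>H\<close> has nonzero fixed vectors on every nonzero
  \<open>H\<close>-stable subspace, \<open>dim (e KG)\<close> is at most \<open>|H|\<close> times the rank \<open>r\<close> of \<open>e\<close> on the space of right
  \<open>H\<close>-invariants, and adding the same estimate for \<open>1 - e\<close> gives equality. In \<open>K\<close>, the rank \<open>r\<close> is the
  trace of \<open>e\<close> on the permutation module of the cosets of \<open>H\<close>. Both this trace and the coefficient at
  the neutral element are insensitive to commutators, so they may be evaluated on
  \<open>e = e ^ (p\<^sup>a)\<close> as if raising to the power \<open>p\<^sup>a\<close> were additive (\<open>trace_of_power_of_sum\<close>). The group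
  elements \<open>g ^ (p\<^sup>a)\<close> that occur have order prime to \<open>p\<close>, and such an element fixes a coset of the
  \<open>p\<close>-group \<open>H\<close> only if it is trivial, in which case it fixes all \<open>m\<close> of them. In characteristic 0 the
  same argument runs with a prime \<open>p\<close> not dividing \<open>|G|\<close> and with \<open>H\<close> trivial; then \<open>r = m e(1)\<close> says
  that \<open>e(1)\<close> is \<open>dim (e KG) / |G|\<close>.
\<close>

section \<open>Fixed points of p-groups and traces of p-th powers\<close>

text \<open>
  Every orbit has \<open>p\<close>-power size, so an orbit with more than one point contributes a multiple of
  \<open>p\<close> to the sum of an invariant function. The hypothesis on \<open>of_nat p\<close> is conditional, here and
  below, so that the trivial group (\<open>k = 0\<close>) is covered in characteristic 0 as well: this is what
  lets one argument treat all characteristics.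
\<close>
lemma p_group_sum_eq_sum_fixed_points:
  fixes F :: "'x \<Rightarrow> 'k::comm_ring_1"
  assumes act: "group_action G E \<phi>" and fin: "finite E"
    and p: "prime p" and ord: "Coset.order G = p ^ k"
    and char: "k > 0 \<Longrightarrow> of_nat p = (0::'k)"
    and inv: "\<And>g x. g \<in> carrier G \<Longrightarrow> x \<in> E \<Longrightarrow> F (\<phi> g x) = F x"
  shows "sum F E = sum F {x \<in> E. \<forall>g \<in> carrier G. \<phi> g x = x}"
proof -
  interpret group_action G E \<phi> by (rule act)
  let ?Fx = "{x \<in> E. \<forall>g \<in> carrier G. \<phi> g x = x}"
  have orb: "sum F O' = sum (\<lambda>x. if x \<in> ?Fx then F x else 0) O'" if O: "O' \<in> orbits G E \<phi>" for O'
  proof -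
    obtain x where x: "x \<in> E" "O' = orbit G \<phi> x" using O by (auto simp: orbits_def)
    have "card O' dvd p ^ k"
      using orbit_stabilizer_theorem[OF x(1)] ord x(2) by (metis dvd_triv_left)
    then obtain i where i: "i \<le> k" "card O' = p ^ i"
      using p by (auto simp: divides_primepow_nat)
    have sub: "O' \<subseteq> E" using O orbits_coverture by blast
    show ?thesis
    proof (cases "i = 0")
      case True
      then have "card O' = 1" using i by simp
      then have "O' = {x}"
        using orbit_refl[OF x(1)] x(2) by (metis card_1_singletonE singletonD)
      then have "x \<in> ?Fx" using x by (auto simp: orbit_def)
      then show ?thesis using \<open>O' = {x}\<close> by simp
    next
      case False
      have "F y = F x" if "y \<in> O'" for y
        using that x inv by (auto simp: orbit_def)
      then have "sum F O' = of_nat (card O') * F x" by simp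
      also have "\<dots> = 0" using char i False by (simp add: zero_power)
      finally have 1: "sum F O' = 0" .
      have "y \<notin> ?Fx" if "y \<in> O'" for y
      proof
        assume "y \<in> ?Fx"
        then have "orbit G \<phi> y = {y}" using orbit_refl[of y] by (auto simp: orbit_def)
        moreover have "orbit G \<phi> y = O'"
          using disjoint_union[OF O, of "orbit G \<phi> y"] that sub \<open>y \<in> ?Fx\<close> orbit_refl[of y]
          by (auto simp: orbits_def)
        ultimately have "p ^ i = 1" using i(2) by simp
        then show False using False p by (simp add: prime_gt_1_nat nat_power_eq_Suc_0_iff not_prime_1)
      qed
      then have "sum (\<lambda>x. if x \<in> ?Fx then F x else 0) O' = 0" by (intro sum.neutral) auto
      then show ?thesis using 1 by simp
    qed
  qed
  have "sum F E = (\<Sum>O'\<in>orbits G E \<phi>. sum F O')"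
    by (rule disjoint_sum[OF fin, symmetric])
  also have "\<dots> = (\<Sum>O'\<in>orbits G E \<phi>. sum (\<lambda>x. if x \<in> ?Fx then F x else 0) O')"
    using orb by (rule sum.cong[OF refl])
  also have "\<dots> = sum (\<lambda>x. if x \<in> ?Fx then F x else 0) E"
    by (rule disjoint_sum[OF fin])
  also have "\<dots> = sum F ?Fx"
    using fin by (subst sum.inter_filter) auto
  finally show ?thesis .
qed

lemma group_actionI:
  assumes G: "group G"
    and closed: "\<And>g x. g \<in> carrier G \<Longrightarrow> x \<in> E \<Longrightarrow> act g x \<in> E"
    and one: "\<And>x. x \<in> E \<Longrightarrow> act \<one>\<^bsub>G\<^esub> x = x"
    and mult: "\<And>g h x. g \<in> carrier G \<Longrightarrow> h \<in> carrier G \<Longrightarrow> x \<in> E \<Longrightarrow>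
      act (g \<otimes>\<^bsub>G\<^esub> h) x = act g (act h x)"
  shows "group_action G E (\<lambda>g. restrict (act g) E)"
proof -
  interpret group G by (rule G)
  have bij: "restrict (act g) E \<in> Bij E" if g: "g \<in> carrier G" for g
  proof -
    have "bij_betw (act g) E E"
    proof (rule bij_betwI)
      show "act (inv\<^bsub>G\<^esub> g) (act g x) = x" if "x \<in> E" for x
        using mult[of "inv\<^bsub>G\<^esub> g" g x] g that one by simp
      show "act g (act (inv\<^bsub>G\<^esub> g) x) = x" if "x \<in> E" for x
        using mult[of g "inv\<^bsub>G\<^esub> g" x] g that one by simp
    qed (use closed g in auto)
    then have "bij_betw (restrict (act g) E) E E"
      by (subst bij_betw_cong[of E _ "act g"]) auto
    then show ?thesis by (simp add: Bij_def)
  qed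
  have "(\<lambda>g. restrict (act g) E) \<in> hom G (BijGroup E)"
  proof (rule homI)
    show "restrict (act g) E \<in> carrier (BijGroup E)" if "g \<in> carrier G" for g
      using bij[OF that] by (simp add: BijGroup_def)
    fix g h assume gh: "g \<in> carrier G" "h \<in> carrier G"
    have "restrict (act (g \<otimes>\<^bsub>G\<^esub> h)) E = compose E (restrict (act g) E) (restrict (act h) E)"
      using gh closed mult by (auto simp: compose_def fun_eq_iff)
    then show "restrict (act (g \<otimes>\<^bsub>G\<^esub> h)) E =
        restrict (act g) E \<otimes>\<^bsub>BijGroup E\<^esub> restrict (act h) E"
      using gh bij by (simp add: BijGroup_def)
  qed
  then show ?thesis
    using G group_BijGroup by (simp add: group_action_def group_hom_def group_hom_axioms_def)
qed

text \<open>
  The noncommutative multinomial expansion, indexed by words so that rotation can act on it.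
\<close>
lemma sum_power_eq_sum_lists:
  fixes y :: "'g::finite \<Rightarrow> 'a::semiring_1"
  shows "(\<Sum>g\<in>UNIV. y g) ^ n = (\<Sum>xs | length xs = n. prod_list (map y xs))"
proof (induction n)
  case (Suc n)
  have *: "{xs. length xs = Suc n} = (\<lambda>(g, xs). g # xs) ` (UNIV \<times> {xs::'g list. length xs = n})"
    by (auto simp: length_Suc_conv image_iff)
  have "(\<Sum>xs | length xs = Suc n. prod_list (map y xs)) =
      (\<Sum>(g, xs)\<in>UNIV \<times> {xs. length xs = n}. y g * prod_list (map y xs))"
    unfolding * by (subst sum.reindex) (auto simp: inj_on_def case_prod_unfold)
  also have "\<dots> = (\<Sum>g\<in>UNIV. y g) * (\<Sum>xs | length xs = n. prod_list (map y xs))"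
    by (simp add: sum_product sum.cartesian_product)
  finally show ?case using Suc by simp
qed simp

lemma trace_prod_list_rotate:
  fixes \<Lambda> :: "'a::monoid_mult \<Rightarrow> 'k"
  assumes "\<And>a b. \<Lambda> (a * b) = \<Lambda> (b * a)"
  shows "\<Lambda> (prod_list (map y (rotate n xs))) = \<Lambda> (prod_list (map y xs))"
proof (induction n)
  case (Suc n)
  have "\<Lambda> (prod_list (map y (rotate1 zs))) = \<Lambda> (prod_list (map y zs))" for zs
    by (cases zs) (auto simp: assms)
  then show ?case using Suc by simp
qed simp

lemma rotate_fixed_imp_replicate:
  assumes "rotate1 xs = xs" "xs \<noteq> []"
  shows "xs = replicate (length xs) (hd xs)"
proof (rule nth_equalityI)
  fix i assume i: "i < length xs"
  have "rotate i xs = xs" by (induction i) (auto simp: assms)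
  then have "hd xs = xs ! (i mod length xs)" by (metis assms(2) hd_rotate_conv_nth)
  then show "xs ! i = replicate (length xs) (hd xs) ! i" using i by simp
qed simp

text \<open>
  The identity \<open>(x + y)\<^sup>q = x\<^sup>q + y\<^sup>q\<close> fails in a noncommutative ring of characteristic \<open>p\<close>, but
  it holds modulo commutators. Expanding the power gives a sum over words of length \<open>q\<close>; a trace
  function takes the same value on the cyclic rotations of a word, the rotations form a group of
  order \<open>q = p ^ k\<close>, and the words fixed by all rotations are the constant ones.
\<close>
lemma trace_of_power_of_sum:
  fixes \<Lambda> :: "'a::semiring_1 \<Rightarrow> 'k::comm_ring_1" and y :: "'g::finite \<Rightarrow> 'a"
  assumes trace: "\<And>a b. \<Lambda> (a * b) = \<Lambda> (b * a)"
    and add: "\<And>a b. \<Lambda> (a + b) = \<Lambda> a + \<Lambda> b" and zero: "\<Lambda> 0 = 0"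
    and p: "prime p" and char: "k > 0 \<Longrightarrow> of_nat p = (0::'k)"
  shows "\<Lambda> ((\<Sum>g\<in>UNIV. y g) ^ (p ^ k)) = (\<Sum>g\<in>UNIV. \<Lambda> (y g ^ (p ^ k)))"
proof -
  define q where "q = p ^ k"
  have q: "q > 0" using p by (simp add: q_def prime_gt_0_nat)
  define E where "E = {xs::'g list. length xs = q}"
  have fin: "finite E" using finite_lists_length_eq[of "UNIV::'g set" q] by (simp add: E_def)
  define F where "F xs = \<Lambda> (prod_list (map y xs))" for xs
  let ?Z = "integer_mod_group q"
  let ?act = "\<lambda>i. restrict (rotate (nat i)) E"
  have carr: "carrier ?Z = {0..<int q}" using q by (simp add: carrier_integer_mod_group)
  have action: "group_action ?Z E ?act"
  proof (rule group_actionI)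
    fix g h :: int and x
    assume "g \<in> carrier ?Z" "h \<in> carrier ?Z" "x \<in> E"
    then have "nat ((g + h) mod int q) = (nat g + nat h) mod length x"
      by (simp add: carr E_def nat_mod_distrib nat_add_distrib)
    then show "rotate (nat (g \<otimes>\<^bsub>?Z\<^esub> h)) x = rotate (nat g) (rotate (nat h) x)"
      by (simp add: rotate_rotate flip: rotate_conv_mod)
  qed (auto simp: E_def)
  have sumF: "\<Lambda> (sum f A) = (\<Sum>a\<in>A. \<Lambda> (f a))" for f :: "'g list \<Rightarrow> 'a" and A
    by (induction A rule: infinite_finite_induct) (auto simp: add zero)
  have "\<Lambda> ((\<Sum>g\<in>UNIV. y g) ^ q) = sum F E"
    by (simp add: sum_power_eq_sum_lists sumF F_def E_def)
  also have "\<dots> = sum F {x \<in> E. \<forall>g \<in> carrier ?Z. ?act g x = x}"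
  proof (rule p_group_sum_eq_sum_fixed_points[where p = p and k = k, OF action fin p])
    show "Coset.order ?Z = p ^ k" unfolding Coset.order_def carr by (simp flip: q_def)
    show "F (?act g x) = F x" if "x \<in> E" for g x
      using that by (simp add: F_def trace_prod_list_rotate[where \<Lambda> = \<Lambda>, OF trace])
    show "of_nat p = (0::'k)" if "k > 0" using char[OF that] .
  qed
  also have "{x \<in> E. \<forall>g \<in> carrier ?Z. ?act g x = x} = range (replicate q)"
  proof (intro equalityI subsetI)
    fix x assume x: "x \<in> {x \<in> E. \<forall>g \<in> carrier ?Z. ?act g x = x}"
    then have len: "length x = q" by (simp add: E_def)
    have "rotate1 x = x"
    proof (cases "q = 1")
      case True then show ?thesis using len by (cases x) auto
    next
      case False
      then have "1 \<in> carrier ?Z" using q by (simp add: carr)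
      then have "?act 1 x = x" using x by blast
      then show ?thesis using x by (simp add: rotate_def)
    qed
    then show "x \<in> range (replicate q)"
      using rotate_fixed_imp_replicate[of x] len q by fastforce
  next
    have "rotate1 (replicate q a) = replicate q a" for a :: 'g
      by (cases q) (auto simp: replicate_append_same)
    then have "rotate n (replicate q a) = replicate q a" for n and a :: 'g
      by (induction n) auto
    then show "x \<in> {x \<in> E. \<forall>g \<in> carrier ?Z. ?act g x = x}" if "x \<in> range (replicate q)" for x
      using that by (auto simp: E_def)
  qed
  also have "sum F (range (replicate q)) = (\<Sum>g\<in>UNIV. F (replicate q g))"
    using q by (subst sum.reindex) (auto simp: inj_on_def replicate_eq_replicate)
  also have "\<dots> = (\<Sum>g\<in>UNIV. \<Lambda> (y g ^ q))"
    by (simp add: F_def)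
  finally show ?thesis by (simp add: q_def)
qed

section \<open>Coefficients and dimensions in the group algebra\<close>

lemma poly_mapping_eq_sum_single:
  fixes x :: "'g::finite \<Rightarrow>\<^sub>0 'k::comm_monoid_add"
  shows "x = (\<Sum>g\<in>UNIV. Poly_Mapping.single g (Poly_Mapping.lookup x g))"
proof (rule poly_mapping_eqI)
  fix k
  have "(\<Sum>g\<in>UNIV. Poly_Mapping.lookup (Poly_Mapping.single g (Poly_Mapping.lookup x g)) k) =
      (\<Sum>g\<in>UNIV. if g = k then Poly_Mapping.lookup x g else 0)"
    by (intro sum.cong) (auto simp: lookup_single when_def)
  then show "Poly_Mapping.lookup x k =
      Poly_Mapping.lookup (\<Sum>g\<in>UNIV. Poly_Mapping.single g (Poly_Mapping.lookup x g)) k"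
    by (simp add: lookup_sum)
qed

lemma lookup_single_mult:
  fixes x :: "'g::{group_add,finite} \<Rightarrow>\<^sub>0 'k::semiring_0"
  shows "Poly_Mapping.lookup (Poly_Mapping.single g c * x) k = c * Poly_Mapping.lookup x (- g + k)"
proof -
  have eq: "g + h = k \<longleftrightarrow> h = - g + k" for h by (metis add_minus_cancel minus_add_cancel)
  have "Poly_Mapping.lookup (Poly_Mapping.single g c * x) k =
      (\<Sum>h\<in>UNIV. Poly_Mapping.lookup (Poly_Mapping.single (g + h) (c * Poly_Mapping.lookup x h)) k)"
    by (subst poly_mapping_eq_sum_single[of x])
      (simp only: sum_distrib_left mult_single lookup_sum)
  also have "\<dots> = (\<Sum>h\<in>UNIV. if h = - g + k then c * Poly_Mapping.lookup x h else 0)"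
    by (intro sum.cong refl) (auto simp: lookup_single when_def eq)
  finally show ?thesis by simp
qed

lemma lookup_mult_single:
  fixes x :: "'g::{group_add,finite} \<Rightarrow>\<^sub>0 'k::semiring_0"
  shows "Poly_Mapping.lookup (x * Poly_Mapping.single g c) k = Poly_Mapping.lookup x (k - g) * c"
proof -
  have eq: "h + g = k \<longleftrightarrow> h = k - g" for h by (metis add_diff_cancel diff_add_cancel)
  have "Poly_Mapping.lookup (x * Poly_Mapping.single g c) k =
      (\<Sum>h\<in>UNIV. Poly_Mapping.lookup (Poly_Mapping.single (h + g) (Poly_Mapping.lookup x h * c)) k)"
    by (subst poly_mapping_eq_sum_single[of x])
      (simp only: sum_distrib_right mult_single lookup_sum)
  also have "\<dots> = (\<Sum>h\<in>UNIV. if h = k - g then Poly_Mapping.lookup x h * c else 0)"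
    by (intro sum.cong refl) (auto simp: lookup_single when_def eq)
  finally show ?thesis by simp
qed

lemma lookup_mult_finite:
  fixes x y :: "'g::{group_add,finite} \<Rightarrow>\<^sub>0 'k::semiring_0"
  shows "Poly_Mapping.lookup (x * y) k = (\<Sum>g\<in>UNIV. Poly_Mapping.lookup x g * Poly_Mapping.lookup y (- g + k))"
proof -
  have "x * y = (\<Sum>g\<in>UNIV. Poly_Mapping.single g (Poly_Mapping.lookup x g)) * y"
    by (subst poly_mapping_eq_sum_single[of x]) (rule refl)
  then show ?thesis by (simp only: sum_distrib_right lookup_sum lookup_single_mult)
qed

context finite_dimensional_vector_space
begin

text \<open>
  A dimension bound without a target space: each functional cuts the dimension down by at most one,
  and all of them together cut \<open>W\<close> down to 0.
\<close>
lemma dim_le_card_separating_functionals: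
  assumes "finite S" "subspace W"
    and "\<And>j x y. j \<in> S \<Longrightarrow> \<phi> j (x + y) = \<phi> j x + \<phi> j y"
    and "\<And>j c x. j \<in> S \<Longrightarrow> \<phi> j (scale c x) = c * \<phi> j x"
    and "\<And>w. w \<in> W \<Longrightarrow> (\<And>j. j \<in> S \<Longrightarrow> \<phi> j w = 0) \<Longrightarrow> w = 0"
  shows "dim W \<le> card S"
  using assms
proof (induction S arbitrary: W rule: finite_induct)
  case empty
  then have "W \<subseteq> {0}" by blast
  then show ?case by simp
next
  case (insert j S)
  have add: "\<phi> j (x + y) = \<phi> j x + \<phi> j y" and scale: "\<phi> j (scale c x) = c * \<phi> j x" for x y c
    using insert.prems by blast+
  have zero: "\<phi> j 0 = 0" using scale[of 0 0] by simp
  let ?W' = "{w \<in> W. \<phi> j w = 0}"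
  have sub: "subspace ?W'"
    using insert.prems(1) by (auto simp: subspace_def add scale zero)
  have IH: "dim ?W' \<le> card S"
  proof (rule insert.IH[OF sub])
    fix w assume "w \<in> ?W'" "\<And>j. j \<in> S \<Longrightarrow> \<phi> j w = 0"
    then show "w = 0" using insert.prems(4)[of w] by auto
  qed (use insert.prems(2,3) in auto)
  show ?case
  proof (cases "W = ?W'")
    case True
    then show ?thesis using IH insert.hyps by simp
  next
    case False
    then obtain w0 where w0: "w0 \<in> W" "\<phi> j w0 \<noteq> 0" by blast
    obtain B where B: "B \<subseteq> ?W'" "independent B" "?W' \<subseteq> span B" "card B = dim ?W'"
      by (rule basis_exists)
    have "W \<subseteq> span (insert w0 B)"
    proof
      fix w assume w: "w \<in> W"
      let ?c = "\<phi> j w / \<phi> j w0"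
      have "\<phi> j (w + scale (- ?c) w0) = 0"
        unfolding add scale using w0(2) by simp
      moreover have "w + scale (- ?c) w0 \<in> W"
        by (intro subspace_add subspace_scale w w0(1) insert.prems(1))
      ultimately have "w - scale ?c w0 \<in> span B" using B(3) by auto
      then show "w \<in> span (insert w0 B)" by (auto simp: span_insert)
    qed
    then have "dim W \<le> card (insert w0 B)"
      using finiteI_independent[OF B(2)] by (intro dim_le_card) auto
    also have "\<dots> \<le> Suc (card B)" by (rule card_insert_le_m1) auto
    finally show ?thesis using IH B(4) insert.hyps by simp
  qed
qed

lemma dim_direct_sum:
  assumes S: "subspace S" and T: "subspace T" and ST: "S \<inter> T = {0}"
  shows "dim {x + y | x y. x \<in> S \<and> y \<in> T} = dim S + dim T"
proof -
  obtain B where B: "B \<subseteq> S" "independent B" "S \<subseteq> span B" "card B = dim S" by (rule basis_exists)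
  obtain C where C: "C \<subseteq> T" "independent C" "T \<subseteq> span C" "card C = dim T" by (rule basis_exists)
  have finB: "finite B" and finC: "finite C" using B C finiteI_independent by auto
  have spB: "span B = S" and spC: "span C = T"
    using span_minimal[OF B(1) S] span_minimal[OF C(1) T] B(3) C(3) by blast+
  have ind: "independent (B \<union> D)" if "finite D" "D \<subseteq> C" for D
    using that
  proof (induction D rule: finite_induct)
    case (insert c D)
    have "c \<notin> span (B \<union> D)"
    proof
      assume "c \<in> span (B \<union> D)"
      then obtain x y where xy: "c = x + y" "x \<in> span B" "y \<in> span D" by (auto simp: span_Un)
      have "span D \<subseteq> T" "c \<in> T" using insert.prems spC span_mono[of D C] span_superset[of C] by auto
      then have "c - y \<in> T" using xy(3) by (intro subspace_diff[OF T]) auto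
      then have "x \<in> S \<inter> T" using xy(1,2) spB by simp
      then have "x = 0" unfolding ST by simp
      then have "c \<in> span D" using xy by simp
      moreover have "D \<subseteq> C - {c}" using insert by auto
      ultimately have "c \<in> span (C - {c})" using span_mono by blast
      then show False using C(2) insert.prems by (auto simp: dependent_def)
    qed
    then have "independent (insert c (B \<union> D))" using insert by (intro independent_insertI) auto
    then show ?case by simp
  qed (simp add: B)
  have "B \<inter> C = {}"
  proof -
    have "0 \<notin> B" using B(2) dependent_zero[of B] by auto
    moreover have "B \<inter> C \<subseteq> {0}" using B(1) C(1) unfolding ST[symmetric] by (rule Int_mono)
    ultimately show ?thesis by auto
  qed
  then have card: "card (B \<union> C) = dim S + dim T"
    unfolding B(4)[symmetric] C(4)[symmetric] using finB finC by (intro card_Un_disjoint)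
  have "span (B \<union> C) = {x + y | x y. x \<in> S \<and> y \<in> T}" by (simp add: span_Un spB spC)
  then show ?thesis
    unfolding card[symmetric] using ind[OF finC order_refl] by (metis dim_span_eq_card_independent)
qed

end

lemma lookup_galg_scale [simp]:
  fixes x :: "'g::{group_add,finite} \<Rightarrow>\<^sub>0 'k::field"
  shows "Poly_Mapping.lookup (galg_scale c x) k = c * Poly_Mapping.lookup x k"
  by (simp add: galg_scale_def lookup_single_mult)

lemma galg_scale_mult_left: "galg_scale c x * y = galg_scale c (x * y)"
  by (simp add: galg_scale_def mult.assoc)

lemma galg_scale_mult_right:
  fixes x :: "'g::{group_add,finite} \<Rightarrow>\<^sub>0 'k::field"
  shows "x * galg_scale c y = galg_scale c (x * y)"
proof -
  have "x * Poly_Mapping.single 0 c = Poly_Mapping.single 0 c * x"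
    by (rule poly_mapping_eqI) (simp add: lookup_single_mult lookup_mult_single)
  then show ?thesis by (simp add: galg_scale_def flip: mult.assoc)
qed

lemma galg_scale_single: "galg_scale c (Poly_Mapping.single g d) = Poly_Mapping.single g (c * d)"
  by (simp add: galg_scale_def mult_single)

abbreviation grp_elem :: "'g::group_add \<Rightarrow> ('g \<Rightarrow>\<^sub>0 'k::field)" where
  "grp_elem g \<equiv> Poly_Mapping.single g 1"

interpretation KG: finite_dimensional_vector_space
  "galg_scale :: 'k::field \<Rightarrow> ('g::{group_add,finite} \<Rightarrow>\<^sub>0 'k) \<Rightarrow> _" "range grp_elem"
proof
  let ?B = "range grp_elem :: ('g \<Rightarrow>\<^sub>0 'k) set"
  have inj: "inj (grp_elem :: 'g \<Rightarrow> ('g \<Rightarrow>\<^sub>0 'k))"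
    by (rule injI) (metis lookup_single_eq lookup_single_not_eq zero_neq_one)
  have coeff: "Poly_Mapping.lookup (\<Sum>x\<in>?B. galg_scale (f x) x) g = f (grp_elem g)" for f g
  proof -
    have "(\<Sum>x\<in>?B. galg_scale (f x) x) = (\<Sum>h\<in>UNIV. Poly_Mapping.single h (f (grp_elem h)))"
      by (subst sum.reindex[OF inj]) (simp add: galg_scale_single)
    also have "Poly_Mapping.lookup \<dots> g = (\<Sum>h\<in>UNIV. if h = g then f (grp_elem h) else 0)"
      unfolding lookup_sum by (intro sum.cong) (auto simp: lookup_single when_def)
    finally show ?thesis by simp
  qed
  show "finite ?B" by simp
  then show "KG.independent ?B"
  proof (rule KG.independent_if_scalars_zero)
    fix f and x :: "'g \<Rightarrow>\<^sub>0 'k"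
    assume "(\<Sum>x\<in>?B. galg_scale (f x) x) = 0" "x \<in> ?B"
    then show "f x = 0" using coeff[of f] by auto
  qed
  have "x \<in> KG.span ?B" for x :: "'g \<Rightarrow>\<^sub>0 'k"
  proof -
    have "x = (\<Sum>g\<in>UNIV. galg_scale (Poly_Mapping.lookup x g) (grp_elem g))"
      using poly_mapping_eq_sum_single[of x] by (simp add: galg_scale_single)
    also have "\<dots> \<in> KG.span ?B"
      by (intro KG.span_sum KG.span_scale KG.span_base) auto
    finally show ?thesis .
  qed
  then show "KG.span ?B = UNIV" by blast
qed

lemma dim_galg_UNIV:
  "KG.dim (UNIV :: ('g::{group_add,finite} \<Rightarrow>\<^sub>0 'k::field) set) = CARD('g)"
proof -
  have inj: "inj (grp_elem :: 'g \<Rightarrow> ('g \<Rightarrow>\<^sub>0 'k))"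
    by (rule injI) (metis lookup_single_eq lookup_single_not_eq zero_neq_one)
  then show ?thesis unfolding KG.dim_UNIV by (rule card_image)
qed

lemma subspace_mult_image:
  fixes e :: "'g::{group_add,finite} \<Rightarrow>\<^sub>0 'k::field"
  assumes W: "KG.subspace W"
  shows "KG.subspace ((\<lambda>x. e * x) ` W)"
  unfolding KG.subspace_def
proof (intro conjI ballI allI)
  show "0 \<in> (\<lambda>x. e * x) ` W" using KG.subspace_0[OF W] by (metis image_eqI mult_zero_right)
  fix x assume "x \<in> (\<lambda>x. e * x) ` W"
  then obtain x' where x: "x = e * x'" "x' \<in> W" by blast
  show "galg_scale c x \<in> (\<lambda>x. e * x) ` W" for c
    using KG.subspace_scale[OF W x(2)] x(1) by (metis galg_scale_mult_right image_eqI)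
  fix y assume "y \<in> (\<lambda>x. e * x) ` W"
  then obtain y' where y: "y = e * y'" "y' \<in> W" by blast
  show "x + y \<in> (\<lambda>x. e * x) ` W"
    using KG.subspace_add[OF W x(2) y(2)] x(1) y(1) by (metis distrib_left image_eqI)
qed

text \<open>
  The Peirce decomposition. It is applied both to the whole group algebra and to the space of
  \<open>H\<close>-invariants, so that inequalities for \<open>e\<close> and \<open>1 - e\<close> can be added and compared.
\<close>
lemma dim_idempotent_split:
  fixes e :: "'g::{group_add,finite} \<Rightarrow>\<^sub>0 'k::field"
  assumes W: "KG.subspace W" and stable: "\<And>x. x \<in> W \<Longrightarrow> e * x \<in> W" and e: "e * e = e"
  shows "KG.dim W = KG.dim ((\<lambda>x. e * x) ` W) + KG.dim ((\<lambda>x. (1 - e) * x) ` W)"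
proof -
  let ?S = "(\<lambda>x. e * x) ` W" and ?T = "(\<lambda>x. (1 - e) * x) ` W"
  have ee: "e * (e * x) = e * x" for x using e by (simp flip: mult.assoc)
  have "?S \<inter> ?T \<subseteq> {0}"
  proof
    fix z assume "z \<in> ?S \<inter> ?T"
    then obtain x y where x: "z = e * x" and y: "z = (1 - e) * y" by blast
    have "z = e * z" unfolding x by (simp add: ee)
    also have "e * z = 0" unfolding y by (simp add: ee left_diff_distrib right_diff_distrib)
    finally show "z \<in> {0}" by simp
  qed
  moreover have "0 \<in> ?S" "0 \<in> ?T"
    using subspace_mult_image[OF W] KG.subspace_0 by blast+
  ultimately have int: "?S \<inter> ?T = {0}" by blast
  have "W = {x + y | x y. x \<in> ?S \<and> y \<in> ?T}"
  proof (intro equalityI subsetI)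
    fix x assume x: "x \<in> W"
    have "x = e * x + (1 - e) * x" by (simp add: left_diff_distrib)
    then show "x \<in> {x + y | x y. x \<in> ?S \<and> y \<in> ?T}" using x by blast
  next
    fix z assume "z \<in> {x + y | x y. x \<in> ?S \<and> y \<in> ?T}"
    then obtain x y where "z = e * x + (1 - e) * y" "x \<in> W" "y \<in> W" by blast
    then show "z \<in> W"
      using stable W by (simp add: left_diff_distrib KG.subspace_add KG.subspace_diff)
  qed
  then show ?thesis
    using KG.dim_direct_sum[OF subspace_mult_image[OF W] subspace_mult_image[OF W] int] by simp
qed

section \<open>Invariants of a p-subgroup\<close>

text \<open>
  The additive group of the type as a record, which makes Sylow's theorem and element orders
  available.
\<close>
definition plus_group :: "'g::group_add monoid" where
  "plus_group = \<lparr>carrier = UNIV, monoid.mult = (+), one = 0\<rparr>"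

lemma plus_group_simps [simp]:
  "carrier plus_group = UNIV" "x \<otimes>\<^bsub>plus_group\<^esub> y = x + y" "\<one>\<^bsub>plus_group\<^esub> = 0"
  by (simp_all add: plus_group_def)

lemma group_plus_group: "group (plus_group :: 'g::group_add monoid)"
proof (rule groupI)
  show "\<exists>y\<in>carrier plus_group. y \<otimes>\<^bsub>plus_group\<^esub> x = \<one>\<^bsub>plus_group\<^esub>" for x :: 'g
    by (rule bexI[of _ "- x"]) auto
qed (auto simp: add.assoc)

lemma inv_plus_group [simp]: "inv\<^bsub>plus_group\<^esub> x = - (x :: 'g::group_add)"
  by (rule group.inv_equality[OF group_plus_group]) auto

lemma subgroup_plus_groupD:
  assumes "subgroup H (plus_group :: 'g::group_add monoid)"
  shows "0 \<in> H" "g \<in> H \<Longrightarrow> h \<in> H \<Longrightarrow> g + h \<in> H" "g \<in> H \<Longrightarrow> - g \<in> H"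
  using subgroup.one_closed[OF assms] subgroup.m_closed[OF assms, of g h]
    subgroup.m_inv_closed[OF assms, of g] by simp_all

definition right_invariants :: "'g::group_add set \<Rightarrow> ('g \<Rightarrow>\<^sub>0 'k::field) set" where
  "right_invariants H = {x. \<forall>h\<in>H. x * grp_elem h = x}"

text \<open>
  A \<open>p\<close>-group acting linearly in characteristic \<open>p\<close> fixes a nonzero vector. The orbit of \<open>a\<close> spans a
  finite space \<open>Y\<close> over the prime field. Translation by \<open>a\<close> acts on \<open>Y\<close> without fixed points, so \<open>p\<close>
  divides \<open>card Y\<close>; hence \<open>p\<close> divides the number of \<open>H\<close>-fixed points in \<open>Y\<close>, and 0 is not the only one.
\<close>
lemma exists_nonzero_right_invariant:
  fixes N :: "('g::{group_add,finite} \<Rightarrow>\<^sub>0 'k::field) set"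
  assumes H: "subgroup H plus_group" and p: "prime p" and card: "card H = p ^ k"
    and char: "k > 0 \<Longrightarrow> of_nat p = (0::'k)"
    and add: "\<And>x y. x \<in> N \<Longrightarrow> y \<in> N \<Longrightarrow> x + y \<in> N" and zero: "0 \<in> N"
    and stable: "\<And>x h. x \<in> N \<Longrightarrow> h \<in> H \<Longrightarrow> x * grp_elem h \<in> N"
    and a: "a \<in> N" "a \<noteq> 0"
  shows "\<exists>x\<in>N \<inter> right_invariants H. x \<noteq> 0"
proof (cases "k = 0")
  case True
  then have "card H = 1" using card by simp
  then have "H = {0}" using subgroup_plus_groupD(1)[OF H] by (metis card_1_singletonE singletonD)
  then have "a \<in> right_invariants H" by (simp add: right_invariants_def)
  then show ?thesis using a by blast
next
  case False
  then have pK: "of_nat p = (0::'k)" using char by simp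
  have pA: "of_nat p = (0 :: 'g \<Rightarrow>\<^sub>0 'k)" by (metis pK single_of_nat single_zero)
  have p0: "p > 0" using p by (simp add: prime_gt_0_nat)
  have of_nat_mod: "of_nat (n mod p) = (of_nat n :: 'g \<Rightarrow>\<^sub>0 'k)" for n
  proof -
    have "(of_nat n :: 'g \<Rightarrow>\<^sub>0 'k) = of_nat (p * (n div p) + n mod p)" by simp
    also have "\<dots> = of_nat (n mod p)" unfolding of_nat_add of_nat_mult pA by simp
    finally show ?thesis by simp
  qed
  \<comment> \<open>Integer combinations of the orbit of \<open>a\<close>; as \<open>p\<close> vanishes, they form the span over the
    prime field.\<close>
  define s :: "('g \<Rightarrow> nat) \<Rightarrow> ('g \<Rightarrow>\<^sub>0 'k)"
    where "s c = (\<Sum>h\<in>H. of_nat (c h) * (a * grp_elem h))" for c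
  define Y where "Y = range s"
  have finY: "finite Y"
  proof (rule finite_subset)
    show "Y \<subseteq> s ` {c. \<forall>h. c h \<in> {..<p}}"
    proof
      fix y assume "y \<in> Y"
      then obtain c where c: "y = s c" by (auto simp: Y_def)
      have "s c = s (\<lambda>h. c h mod p)" by (simp add: s_def of_nat_mod)
      then show "y \<in> s ` {c. \<forall>h. c h \<in> {..<p}}" using c p0 by auto
    qed
    have "finite {c::'g \<Rightarrow> nat. \<forall>h. (h \<in> UNIV \<longrightarrow> c h \<in> {..<p}) \<and> (h \<notin> UNIV \<longrightarrow> c h = 0)}"
      by (rule finite_set_of_finite_funs) auto
    then show "finite (s ` {c. \<forall>h. c h \<in> {..<p}})" by simp
  qed
  have Y0: "0 \<in> Y"
  proof -
    have "s (\<lambda>_. 0) = 0" by (simp add: s_def)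
    then show ?thesis unfolding Y_def by (metis rangeI)
  qed
  have YN: "y \<in> N" if "y \<in> Y" for y
  proof -
    have nat: "of_nat n * x \<in> N" if "x \<in> N" for n x
      using that by (induction n) (auto simp: zero add distrib_right)
    have "(\<Sum>h\<in>D. of_nat (c h) * (a * grp_elem h)) \<in> N" if "finite D" "D \<subseteq> H" for D c
      using that by (induction D rule: finite_induct) (auto simp: zero intro!: add nat stable a)
    then show ?thesis using that by (auto simp: Y_def s_def)
  qed
  have Yadd: "y + of_nat n * a \<in> Y" if "y \<in> Y" for y n
  proof -
    obtain c where c: "y = s c" using \<open>y \<in> Y\<close> by (auto simp: Y_def)
    let ?c' = "\<lambda>h. c h + (if h = 0 then n else 0)"
    have "s ?c' = s c + (\<Sum>h\<in>H. (if h = 0 then of_nat n * (a * grp_elem h) else 0))"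
      unfolding s_def sum.distrib[symmetric] by (intro sum.cong) (auto simp: distrib_right)
    also have "\<dots> = y + of_nat n * a" using subgroup_plus_groupD(1)[OF H] c by simp
    finally have "y + of_nat n * a = s ?c'" by (rule sym)
    then show ?thesis unfolding Y_def by (rule range_eqI[where f = s])
  qed
  have Ystable: "y * grp_elem h \<in> Y" if "y \<in> Y" "h \<in> H" for y h
  proof -
    obtain c where c: "y = s c" using \<open>y \<in> Y\<close> by (auto simp: Y_def)
    have "y * grp_elem h = (\<Sum>g\<in>H. of_nat (c g) * (a * grp_elem (g + h)))"
      by (simp add: c s_def sum_distrib_right mult.assoc mult_single)
    also have "\<dots> = (\<Sum>g\<in>H. of_nat (c (g - h)) * (a * grp_elem g))"
    proof (rule sum.reindex_bij_witness[of _ "\<lambda>g. g - h" "\<lambda>g. g + h"])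
      show "g - h \<in> H" if "g \<in> H" for g
        using subgroup_plus_groupD(2)[OF H that subgroup_plus_groupD(3)[OF H \<open>h \<in> H\<close>]] by simp
    qed (use subgroup_plus_groupD(2)[OF H] \<open>h \<in> H\<close> in auto)
    also have "\<dots> = s (\<lambda>g. c (g - h))" by (simp add: s_def)
    finally show ?thesis by (simp add: Y_def)
  qed
  have cardY: "of_nat (card Y) = (0::'k)"
  proof -
    let ?Z = "integer_mod_group p"
    let ?act = "\<lambda>i y. y + of_nat (nat i) * a"
    have carr: "carrier ?Z = {0..<int p}" using p0 by (simp add: carrier_integer_mod_group)
    have action: "group_action ?Z Y (\<lambda>i. restrict (?act i) Y)"
    proof (rule group_actionI)
      fix g h :: int and y
      assume "g \<in> carrier ?Z" "h \<in> carrier ?Z"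
      then have "nat ((g + h) mod int p) = (nat g + nat h) mod p"
        by (simp add: carr nat_mod_distrib nat_add_distrib)
      then show "?act (g \<otimes>\<^bsub>?Z\<^esub> h) y = ?act g (?act h y)"
        by (simp add: of_nat_mod distrib_right add_ac)
    qed (auto simp: Yadd)
    have "(\<Sum>y\<in>Y. 1::'k) = (\<Sum>y\<in>{y\<in>Y. \<forall>i\<in>carrier ?Z. restrict (?act i) Y y = y}. 1)"
    proof (rule p_group_sum_eq_sum_fixed_points[where p = p and k = 1, OF action finY p])
      show "Coset.order ?Z = p ^ 1" unfolding Coset.order_def carr by simp
    qed (use pK in auto)
    also have "{y\<in>Y. \<forall>i\<in>carrier ?Z. restrict (?act i) Y y = y} = {}"
    proof -
      have "(1::int) \<in> carrier ?Z" using prime_gt_1_nat[OF p] by (simp add: carr)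
      moreover have "restrict (?act 1) Y y \<noteq> y" if "y \<in> Y" for y using that a(2) by simp
      ultimately show ?thesis by blast
    qed
    finally show ?thesis by simp
  qed
  have grpH: "group (plus_group\<lparr>carrier := H\<rparr>)"
    by (rule subgroup.subgroup_is_group[OF H group_plus_group])
  \<comment> \<open>The inverse turns right multiplication into a left action.\<close>
  let ?act = "\<lambda>g y. y * grp_elem (- g)"
  let ?Fx = "{y\<in>Y. \<forall>g\<in>carrier (plus_group\<lparr>carrier := H\<rparr>). restrict (?act g) Y y = y}"
  have action: "group_action (plus_group\<lparr>carrier := H\<rparr>) Y (\<lambda>g. restrict (?act g) Y)"
    by (rule group_actionI[OF grpH])
      (auto simp: Ystable subgroup_plus_groupD[OF H] mult.assoc mult_single minus_add)
  have "(\<Sum>y\<in>Y. 1::'k) = (\<Sum>y\<in>?Fx. 1)"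
    by (rule p_group_sum_eq_sum_fixed_points[where p = p and k = k, OF action finY p])
      (auto simp: Coset.order_def card pK)
  then have card_Fx: "of_nat (card ?Fx) = (0::'k)" using cardY by simp
  have "?Fx \<noteq> {0}"
  proof
    assume eq: "?Fx = {0}"
    show False using card_Fx unfolding eq by simp
  qed
  moreover have "0 \<in> ?Fx" using Y0 by auto
  ultimately obtain y where y: "y \<in> ?Fx" "y \<noteq> 0" by blast
  have "y * grp_elem h = y" if "h \<in> H" for h
    using y(1) subgroup_plus_groupD(3)[OF H that] by force
  then show ?thesis using y YN by (auto simp: right_invariants_def)
qed

lemma subspace_right_invariants:
  "KG.subspace (right_invariants H :: ('g::{group_add,finite} \<Rightarrow>\<^sub>0 'k::field) set)"
  by (auto simp: KG.subspace_def right_invariants_def distrib_right galg_scale_mult_left)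

text \<open>
  In module terms, \<open>N\<close> embeds into a free module over the group algebra of \<open>H\<close> whose rank is the
  dimension of the invariants of \<open>N\<close>. Concretely, extend the coordinates on the invariants to linear
  functionals on the whole space and translate them by \<open>H\<close>. Their common kernel on \<open>N\<close> is stable
  under \<open>H\<close>; if it were nonzero, it would contain a nonzero invariant, on which some coordinate is
  nonzero.
\<close>
lemma dim_le_card_mult_dim_right_invariants:
  fixes N :: "('g::{group_add,finite} \<Rightarrow>\<^sub>0 'k::field) set"
  assumes H: "subgroup H plus_group" and p: "prime p" and card: "card H = p ^ k"
    and char: "k > 0 \<Longrightarrow> of_nat p = (0::'k)"
    and N: "KG.subspace N"
    and stable: "\<And>x h. x \<in> N \<Longrightarrow> h \<in> H \<Longrightarrow> x * grp_elem h \<in> N"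
  shows "KG.dim N \<le> card H * KG.dim (N \<inter> right_invariants H)"
proof -
  obtain B where B: "B \<subseteq> N \<inter> right_invariants H" "KG.independent B"
    "N \<inter> right_invariants H \<subseteq> KG.span B" "card B = KG.dim (N \<inter> right_invariants H)"
    by (rule KG.basis_exists)
  have finB: "finite B" by (rule KG.finiteI_independent[OF B(2)])
  \<comment> \<open>Coordinates in an extended basis \<open>C\<close> extend the coordinates in \<open>B\<close> to the whole space.\<close>
  define C where "C = KG.extend_basis B"
  have C: "KG.independent C" "KG.span C = UNIV" "B \<subseteq> C"
    using KG.independent_extend_basis[OF B(2)] KG.span_extend_basis[OF B(2)]
      KG.extend_basis_superset[OF B(2)] by (simp_all add: C_def)
  define \<phi> where "\<phi> = (\<lambda>(b, h) y. KG.representation C (y * grp_elem h) b)"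
  have inC: "y \<in> KG.span C" for y using C(2) by simp
  have add: "\<phi> j (x + y) = \<phi> j x + \<phi> j y" for j x y
    by (cases j) (simp add: \<phi>_def distrib_right KG.representation_add[OF C(1) inC inC])
  have scale: "\<phi> j (galg_scale c x) = c * \<phi> j x" for j c x
    by (cases j) (simp add: \<phi>_def galg_scale_mult_left KG.representation_scale[OF C(1) inC])
  have zero: "\<phi> j 0 = 0" for j by (cases j) (simp add: \<phi>_def KG.representation_zero)
  have "KG.dim N \<le> card (B \<times> H)"
  proof (rule KG.dim_le_card_separating_functionals[where \<phi> = \<phi>, OF _ N add scale])
    show "finite (B \<times> H)" using finB by simp
    fix a assume a: "a \<in> N" "\<And>j. j \<in> B \<times> H \<Longrightarrow> \<phi> j a = 0"
    define N0 where "N0 = {y \<in> N. \<forall>j\<in>B \<times> H. \<phi> j y = 0}"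
    show "a = 0"
    proof (rule ccontr)
      assume "a \<noteq> 0"
      have "\<exists>x\<in>N0 \<inter> right_invariants H. x \<noteq> 0"
      proof (rule exists_nonzero_right_invariant[OF H p card char])
        show "a \<in> N0" using a by (simp add: N0_def)
        show "0 \<in> N0" by (auto simp: N0_def zero KG.subspace_0[OF N])
        show "x + y \<in> N0" if "x \<in> N0" "y \<in> N0" for x y
          using that by (auto simp: N0_def add KG.subspace_add[OF N])
        show "x * grp_elem h \<in> N0" if x: "x \<in> N0" and h: "h \<in> H" for x h
        proof -
          have "\<phi> (b, h') (x * grp_elem h) = \<phi> (b, h + h') x" for b h'
            by (simp add: \<phi>_def mult.assoc mult_single)
          then show ?thesis
            using x h subgroup_plus_groupD(2)[OF H h] stable by (auto simp: N0_def)
        qed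
      qed (use \<open>a \<noteq> 0\<close> in auto)
      then obtain x where x: "x \<in> N0" "x \<in> right_invariants H" "x \<noteq> 0" by blast
      have xB: "x \<in> KG.span B" using x(1,2) B(3) by (auto simp: N0_def)
      have "KG.representation B x b = 0" if "b \<in> B" for b
      proof -
        have "\<phi> (b, 0) x = 0"
          using x(1) that subgroup_plus_groupD(1)[OF H] by (auto simp: N0_def)
        then show ?thesis
          using KG.representation_extend[OF C(1) xB C(3)] by (simp add: \<phi>_def)
      qed
      moreover have "(\<Sum>b\<in>B. galg_scale (KG.representation B x b) b) = x"
        by (rule KG.sum_representation_eq[OF B(2) xB finB order_refl])
      ultimately have "x = 0" by simp
      then show False using x(3) by simp
    qed
  qed
  then show ?thesis using B(4) by (simp add: card_cartesian_product mult.commute)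
qed

lemma single_power:
  "Poly_Mapping.single g c ^ n = Poly_Mapping.single (g [^]\<^bsub>plus_group\<^esub> n) (c ^ n)"
  for g :: "'g::group_add" and c :: "'k::field"
proof (induction n)
  case (Suc n)
  have "Poly_Mapping.single g c ^ Suc n = Poly_Mapping.single g c ^ n * Poly_Mapping.single g c"
    by (rule power_Suc2)
  then show ?case unfolding Suc mult_single by (simp add: mult.commute)
qed simp

lemma conjugate_plus_group_pow:
  "(- g + x + g) [^]\<^bsub>plus_group\<^esub> (n::nat) = - g + x [^]\<^bsub>plus_group\<^esub> n + g"
  for g x :: "'g::group_add"
  by (induction n) (simp_all add: add.assoc)

text \<open>
  The element \<open>z = x [^] (p ^ a)\<close> has order prime to \<open>p\<close>, whereas conjugates of elements of the
  \<open>p\<close>-group \<open>H\<close> have \<open>p\<close>-power order. So \<open>z\<close> fixes a coset of \<open>H\<close> only if it is the neutral element.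
\<close>
lemma p_part_power_conjugate_in_p_subgroup_imp_zero:
  fixes x :: "'g::{group_add,finite}"
  assumes H: "subgroup H plus_group" and p: "prime p" and card: "card H = p ^ a"
    and n: "CARD('g) = p ^ a * m" and m: "\<not> p dvd m"
    and conj: "- g + - (x [^]\<^bsub>plus_group\<^esub> (p ^ a)) + g \<in> H"
  shows "x [^]\<^bsub>plus_group\<^esub> (p ^ a) = 0"
proof -
  interpret group "plus_group :: 'g monoid" by (rule group_plus_group)
  interpret H: group "plus_group\<lparr>carrier := H\<rparr>"
    by (rule subgroup.subgroup_is_group[OF H group_plus_group])
  let ?z = "x [^]\<^bsub>plus_group\<^esub> (p ^ a)"
  have "(- g + - ?z + g) [^]\<^bsub>plus_group\<lparr>carrier := H\<rparr>\<^esub> (p ^ a) = 0"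
    using H.pow_order_eq_1[of "- g + - ?z + g"] conj by (simp add: Coset.order_def card)
  then have "- g + (- ?z) [^]\<^bsub>plus_group\<^esub> (p ^ a) + g = 0"
    unfolding conjugate_plus_group_pow[symmetric] nat_pow_consistent[symmetric] .
  then have "(- ?z) [^]\<^bsub>plus_group\<^esub> (p ^ a) = 0"
    by (metis add.assoc add.right_neutral add_minus_cancel minus_add_cancel neg_eq_iff_add_eq_0 add.left_neutral)
  then have "- (?z [^]\<^bsub>plus_group\<^esub> (p ^ a)) = 0"
    using nat_pow_inv[of ?z "p ^ a"] by simp
  then have "x [^]\<^bsub>plus_group\<^esub> (p ^ a * p ^ a) = \<one>\<^bsub>plus_group\<^esub>"
    using nat_pow_pow[of x "p ^ a" "p ^ a"] by simp
  then have "ord x dvd p ^ (a + a)"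
    unfolding power_add using pow_eq_id[of x] by simp
  then obtain i where i: "ord x = p ^ i" using p by (auto simp: divides_primepow_nat)
  have "p ^ i dvd p ^ a * m"
    using ord_dvd_group_order[of x] i n by (simp add: Coset.order_def)
  moreover have "coprime (p ^ i) m"
    using p m by (simp add: prime_imp_coprime)
  ultimately have "ord x dvd p ^ a" using i by (simp add: coprime_dvd_mult_left_iff)
  then show ?thesis using pow_eq_id[of x "p ^ a"] by simp
qed

section \<open>The trace on the permutation module of cosets\<close>

text \<open>
  The bijection \<open>R \<times> H \<rightarrow> G\<close> says at once that the cosets \<open>r + H\<close> are distinct, that they
  cover the group, and that \<open>card R\<close> is the index of \<open>H\<close>.
\<close>
definition left_transversal :: "'g::group_add set \<Rightarrow> 'g set \<Rightarrow> bool" where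
  "left_transversal R H \<longleftrightarrow> bij_betw (\<lambda>(r, h). r + h) (R \<times> H) UNIV"

lemma exists_left_transversal:
  fixes H :: "'g::group_add set"
  assumes H: "subgroup H plus_group"
  shows "\<exists>R. left_transversal R H"
proof -
  note D = subgroup_plus_groupD[OF H]
  define coset where "coset g = (\<lambda>h. g + h) ` H" for g
  define rep where "rep C = (SOME r. r \<in> C)" for C :: "'g set"
  have coset_eq: "coset (g + h) = coset g" if h: "h \<in> H" for g h
  proof (intro equalityI subsetI)
    fix y assume "y \<in> coset (g + h)"
    then show "y \<in> coset g" using D(2)[OF h] by (auto simp: coset_def add.assoc)
  next
    fix y assume "y \<in> coset g"
    then obtain k where k: "k \<in> H" "y = g + k" by (auto simp: coset_def)
    then have "y = g + h + (- h + k)" by (simp add: add.assoc)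
    then show "y \<in> coset (g + h)" using D(2)[OF D(3)[OF h] k(1)] by (auto simp: coset_def)
  qed
  have "g \<in> coset g" for g using D(1) by (auto simp: coset_def intro: image_eqI[of _ _ 0])
  then have rep: "rep (coset g) \<in> coset g" for g unfolding rep_def by (rule someI)
  define R where "R = range (\<lambda>g. rep (coset g))"
  have repR: "rep (coset r) = r" if "r \<in> R" for r
  proof -
    obtain g where g: "r = rep (coset g)" using \<open>r \<in> R\<close> by (auto simp: R_def)
    then obtain h where "h \<in> H" "r = g + h" using rep[of g] by (auto simp: coset_def)
    then show ?thesis using g coset_eq by simp
  qed
  have "bij_betw (\<lambda>(r, h). r + h) (R \<times> H) UNIV"
    unfolding bij_betw_def
  proof (intro conjI inj_onI)
    fix u v assume "u \<in> R \<times> H" "v \<in> R \<times> H" and eq: "(\<lambda>(r, h). r + h) u = (\<lambda>(r, h). r + h) v"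
    then obtain r h r' h' where u: "u = (r, h)" "v = (r', h')" "r \<in> R" "r' \<in> R" "h \<in> H" "h' \<in> H"
      by auto
    then have rh: "r + h = r' + h'" using eq by simp
    have "r = r'" using repR[of r] repR[of r'] coset_eq[of h r] coset_eq[of h' r'] rh u by metis
    then show "u = v" using u rh by simp
  next
    have "g \<in> (\<lambda>(r, h). r + h) ` (R \<times> H)" for g
    proof -
      obtain h where h: "h \<in> H" "rep (coset g) = g + h" using rep[of g] by (auto simp: coset_def)
      then have "g = rep (coset g) + - h" by (simp add: add.assoc)
      moreover have "rep (coset g) \<in> R" by (simp add: R_def)
      ultimately have "g = (\<lambda>(r, h). r + h) (rep (coset g), - h)"
        "(rep (coset g), - h) \<in> R \<times> H" using D(3)[OF h(1)] by simp_all
      then show ?thesis by (rule image_eqI)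
    qed
    then show "(\<lambda>(r, h). r + h) ` (R \<times> H) = UNIV" by blast
  qed
  then show ?thesis by (auto simp: left_transversal_def)
qed

text \<open>
  The space of right \<open>H\<close>-invariants is the permutation module on the cosets of \<open>H\<close>: the elements
  \<open>g \<cdot> hsum\<close> with \<open>g \<in> R\<close> form a basis. The parameter \<open>field_type\<close> only serves to fix the
  coefficient field.
\<close>
locale group_algebra_transversal =
  fixes H R :: "'g::{group_add,finite} set" and field_type :: "'k::field itself"
  assumes H: "subgroup H plus_group" and R: "left_transversal R H"
begin

abbreviation hsum :: "'g \<Rightarrow>\<^sub>0 'k" where
  "hsum \<equiv> (\<Sum>h\<in>H. grp_elem h)"

abbreviation invs :: "('g \<Rightarrow>\<^sub>0 'k) set" where
  "invs \<equiv> right_invariants H"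

text \<open>
  This is the trace of left multiplication by \<open>x\<close> on the invariants, computed in the basis
  \<open>g \<cdot> hsum\<close>, since the coefficient at \<open>g \<in> R\<close> is the coordinate belonging to \<open>g\<close>.
\<close>
definition coset_trace :: "('g \<Rightarrow>\<^sub>0 'k) \<Rightarrow> 'k" where
  "coset_trace x = (\<Sum>g\<in>R. Poly_Mapping.lookup (x * (grp_elem g * hsum)) g)"

lemma card_transversal_mult: "card R * card H = CARD('g)"
  using bij_betw_same_card[of "\<lambda>(r, h). r + h" "R \<times> H" UNIV] R
  by (simp add: left_transversal_def card_cartesian_product)

lemma transversal_unique: "g \<in> R \<Longrightarrow> r \<in> R \<Longrightarrow> - g + r \<in> H \<Longrightarrow> g = r"
proof -
  assume gr: "g \<in> R" "r \<in> R" "- g + r \<in> H"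
  have "(g, - g + r) = (r, 0)"
    by (rule inj_onD[of "\<lambda>(r, h). r + h" "R \<times> H"])
      (use R gr subgroup_plus_groupD(1)[OF H] in \<open>auto simp: left_transversal_def bij_betw_def\<close>)
  then show "g = r" by simp
qed

lemma transversal_decomp: obtains r h where "r \<in> R" "h \<in> H" "g = r + h"
proof -
  have "g \<in> (\<lambda>(r, h). r + h) ` (R \<times> H)"
    using R by (simp add: left_transversal_def bij_betw_def)
  then show ?thesis using that by auto
qed

lemma lookup_hsum: "Poly_Mapping.lookup hsum g = (if g \<in> H then 1 else 0)"
proof -
  have "Poly_Mapping.lookup hsum g = (\<Sum>h\<in>H. if h = g then 1 else 0)"
    unfolding lookup_sum by (intro sum.cong) (auto simp: lookup_single when_def)
  then show ?thesis by simp
qed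

lemma hsum_invariant: "hsum \<in> invs"
  unfolding right_invariants_def
proof (intro CollectI ballI poly_mapping_eqI)
  fix h k assume h: "h \<in> H"
  have "k - h \<in> H \<longleftrightarrow> k \<in> H"
    using subgroup_plus_groupD(2)[OF H, of "k - h" h] subgroup_plus_groupD(2)[OF H, of k "- h"]
      subgroup_plus_groupD(3)[OF H h] h by auto
  then show "Poly_Mapping.lookup (hsum * grp_elem h) k = Poly_Mapping.lookup hsum k"
    by (simp add: lookup_mult_single lookup_hsum)
qed

lemma mult_invariant: "x \<in> invs \<Longrightarrow> y * x \<in> invs"
  by (simp add: right_invariants_def mult.assoc)

lemma invariant_lookup: "x \<in> invs \<Longrightarrow> h \<in> H \<Longrightarrow> Poly_Mapping.lookup x (g + h) = Poly_Mapping.lookup x g"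
proof -
  assume x: "x \<in> invs" and h: "h \<in> H"
  have "x * grp_elem h = x" using x h by (simp add: right_invariants_def)
  then have "Poly_Mapping.lookup x (g + h) = Poly_Mapping.lookup (x * grp_elem h) (g + h)" by simp
  then show ?thesis by (simp add: lookup_mult_single)
qed

lemma invariant_expansion:
  assumes x: "x \<in> invs"
  shows "x = (\<Sum>g\<in>R. galg_scale (Poly_Mapping.lookup x g) (grp_elem g * hsum))"
proof (rule poly_mapping_eqI)
  fix k
  obtain r h where k: "r \<in> R" "h \<in> H" "k = r + h" by (rule transversal_decomp)
  have "- g + k \<in> H \<longleftrightarrow> g = r" if g: "g \<in> R" for g
  proof
    assume "- g + k \<in> H"
    then have "- g + k + - h \<in> H"
      using subgroup_plus_groupD(2)[OF H] subgroup_plus_groupD(3)[OF H k(2)] by blast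
    moreover have "- g + k + - h = - g + r"
      unfolding k(3) by (simp only: add.assoc add.right_inverse add.right_neutral)
    ultimately have "- g + r \<in> H" by simp
    then show "g = r" using transversal_unique g k(1) by blast
  qed (use k in simp)
  then have "Poly_Mapping.lookup (\<Sum>g\<in>R. galg_scale (Poly_Mapping.lookup x g) (grp_elem g * hsum)) k
      = (\<Sum>g\<in>R. if g = r then Poly_Mapping.lookup x g else 0)"
    unfolding lookup_sum
    by (intro sum.cong) (auto simp: lookup_single_mult lookup_hsum)
  also have "\<dots> = Poly_Mapping.lookup x r" using k(1) by simp
  also have "\<dots> = Poly_Mapping.lookup x k" using invariant_lookup[OF x k(2)] k(3) by simp
  finally show "Poly_Mapping.lookup x k =
      Poly_Mapping.lookup (\<Sum>g\<in>R. galg_scale (Poly_Mapping.lookup x g) (grp_elem g * hsum)) k" ..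
qed

lemma dim_invs_le: "KG.dim invs \<le> card R"
proof (rule KG.dim_le_card_separating_functionals[where \<phi> = "\<lambda>g x. Poly_Mapping.lookup x g",
      OF _ subspace_right_invariants])
  show "w = 0" if "w \<in> invs" "\<And>g. g \<in> R \<Longrightarrow> Poly_Mapping.lookup w g = 0" for w
    using invariant_expansion[OF that(1)] that(2) by simp
qed (simp_all add: lookup_add)

lemma coset_trace_add: "coset_trace (x + y) = coset_trace x + coset_trace y"
  by (simp add: coset_trace_def distrib_right lookup_add sum.distrib)

lemma coset_trace_zero: "coset_trace 0 = 0"
  by (simp add: coset_trace_def)

lemma coset_trace_mult:
  "coset_trace (x * y) = (\<Sum>g\<in>R. \<Sum>g'\<in>R. Poly_Mapping.lookup (y * (grp_elem g * hsum)) g' *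
     Poly_Mapping.lookup (x * (grp_elem g' * hsum)) g)"
  unfolding coset_trace_def
proof (intro sum.cong refl)
  fix g
  let ?y = "y * (grp_elem g * hsum)"
  have "?y \<in> invs" by (intro mult_invariant hsum_invariant)
  have "x * y * (grp_elem g * hsum) = x * ?y" by (rule mult.assoc)
  also have "\<dots> = x * (\<Sum>g'\<in>R. galg_scale (Poly_Mapping.lookup ?y g') (grp_elem g' * hsum))"
    using invariant_expansion[OF \<open>?y \<in> invs\<close>] by (rule arg_cong)
  also have "\<dots> = (\<Sum>g'\<in>R. galg_scale (Poly_Mapping.lookup ?y g') (x * (grp_elem g' * hsum)))"
    by (simp only: sum_distrib_left galg_scale_mult_right)
  finally show "Poly_Mapping.lookup (x * y * (grp_elem g * hsum)) g =
      (\<Sum>g'\<in>R. Poly_Mapping.lookup ?y g' * Poly_Mapping.lookup (x * (grp_elem g' * hsum)) g)"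
    by (simp only: lookup_sum lookup_galg_scale)
qed

lemma coset_trace_commute: "coset_trace (x * y) = coset_trace (y * x)"
  unfolding coset_trace_mult by (subst sum.swap) (simp only: mult.commute)

text \<open>
  The trace of a group element on a permutation module counts the cosets that it fixes; the
  hypothesis says that only the neutral element fixes any.
\<close>
lemma coset_trace_single:
  assumes "\<And>g. - g + - z + g \<in> H \<Longrightarrow> z = 0"
  shows "coset_trace (Poly_Mapping.single z c) = (if z = 0 then of_nat (card R) * c else 0)"
proof -
  have "Poly_Mapping.lookup (Poly_Mapping.single z c * (grp_elem g * hsum)) g =
      (if z = 0 then c else 0)" for g
    using assms[of g, unfolded add.assoc] subgroup_plus_groupD(1)[OF H]
    by (auto simp: lookup_single_mult lookup_hsum add.assoc)
  then show ?thesis by (simp add: coset_trace_def)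
qed

text \<open>
  The trace of a projection is its rank: write \<open>e\<close> as a sum of rank one operators \<open>b \<otimes> \<rho> b\<close>,
  where \<open>b\<close> runs through a basis of the image and \<open>\<rho> b\<close> takes the coordinate at \<open>b\<close>; each of them
  has trace \<open>\<rho> b b = 1\<close>.
\<close>
lemma coset_trace_idempotent:
  assumes e: "e * e = e"
  shows "coset_trace e = of_nat (KG.dim ((\<lambda>x. e * x) ` invs))"
proof -
  let ?W = "(\<lambda>x. e * x) ` invs"
  obtain B where B: "B \<subseteq> ?W" "KG.independent B" "?W \<subseteq> KG.span B" "card B = KG.dim ?W"
    by (rule KG.basis_exists)
  have finB: "finite B" by (rule KG.finiteI_independent[OF B(2)])
  define \<rho> where "\<rho> x b = KG.representation B (e * x) b" for x b
  have Binv: "b \<in> invs" and eb: "e * b = b" if b: "b \<in> B" for b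
  proof -
    obtain x where x: "b = e * x" "x \<in> invs" using B(1) b by blast
    show "b \<in> invs" using x mult_invariant by simp
    show "e * b = b" using x(1) e by (simp flip: mult.assoc)
  qed
  have span: "e * x \<in> KG.span B" if "x \<in> invs" for x using that B(3) by blast
  have gs: "grp_elem g * hsum \<in> invs" for g by (intro mult_invariant hsum_invariant)
  have expand: "e * x = (\<Sum>b\<in>B. galg_scale (\<rho> x b) b)" if "x \<in> invs" for x
    using KG.sum_representation_eq[OF B(2) span[OF that] finB order_refl] by (simp add: \<rho>_def)
  have "coset_trace e = (\<Sum>g\<in>R. \<Sum>b\<in>B. \<rho> (grp_elem g * hsum) b * Poly_Mapping.lookup b g)"
    unfolding coset_trace_def by (simp add: expand[OF gs] lookup_sum)
  also have "\<dots> = (\<Sum>b\<in>B. \<Sum>g\<in>R. \<rho> (grp_elem g * hsum) b * Poly_Mapping.lookup b g)"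
    by (rule sum.swap)
  also have "\<dots> = (\<Sum>b\<in>B. \<rho> b b)"
  proof (intro sum.cong refl)
    fix b assume b: "b \<in> B"
    have "e * b = e * (\<Sum>g\<in>R. galg_scale (Poly_Mapping.lookup b g) (grp_elem g * hsum))"
      using invariant_expansion[OF Binv[OF b]] by (rule arg_cong)
    also have "\<dots> = (\<Sum>g\<in>R. galg_scale (Poly_Mapping.lookup b g) (e * (grp_elem g * hsum)))"
      by (simp only: sum_distrib_left galg_scale_mult_right)
    finally have "\<rho> b b = (\<Sum>g\<in>R. Poly_Mapping.lookup b g * \<rho> (grp_elem g * hsum) b)"
      by (simp add: \<rho>_def KG.representation_sum KG.representation_scale B(2) span gs
          KG.span_scale)
    then show "(\<Sum>g\<in>R. \<rho> (grp_elem g * hsum) b * Poly_Mapping.lookup b g) = \<rho> b b"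
      by (simp add: mult.commute)
  qed
  also have "\<dots> = (\<Sum>b\<in>B. 1)"
    by (intro sum.cong refl) (simp add: \<rho>_def eb KG.representation_basis[OF B(2)])
  finally show ?thesis using B(4) by simp
qed

text \<open>
  Only inequalities are available for \<open>e\<close> and for \<open>1 - e\<close> separately, but the left-hand sides add up
  to \<open>|G|\<close>, and the right-hand sides to at most \<open>|H| \<cdot> |R| = |G|\<close>, so both are equalities.
\<close>
lemma dim_ideal_eq_card_mult_dim_invariants:
  assumes e: "e * e = e"
    and p: "prime p" and card: "card H = p ^ k" and char: "k > 0 \<Longrightarrow> of_nat p = (0::'k)"
  shows "KG.dim (range (\<lambda>x. e * x)) = card H * KG.dim ((\<lambda>x. e * x) ` invs)"
proof -
  have le: "KG.dim (range (\<lambda>x. f * x)) \<le> card H * KG.dim ((\<lambda>x. f * x) ` invs)"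
    if f: "f * f = f" for f :: "'g \<Rightarrow>\<^sub>0 'k"
  proof -
    have "range (\<lambda>x. f * x) \<inter> invs = (\<lambda>x. f * x) ` invs"
    proof (intro equalityI subsetI)
      fix y assume y: "y \<in> range (\<lambda>x. f * x) \<inter> invs"
      then obtain x where "y = f * x" by blast
      then have "y = f * y" using f by (simp flip: mult.assoc)
      then show "y \<in> (\<lambda>x. f * x) ` invs" using y by blast
    qed (auto simp: mult_invariant)
    moreover have "KG.dim (range (\<lambda>x. f * x)) \<le>
        card H * KG.dim (range (\<lambda>x. f * x) \<inter> invs)"
      by (rule dim_le_card_mult_dim_right_invariants[OF H p card char])
        (auto simp: subspace_mult_image mult.assoc)
    ultimately show ?thesis by simp
  qed
  have e': "(1 - e) * (1 - e) = 1 - e" using e by (simp add: left_diff_distrib right_diff_distrib)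
  have "CARD('g) = KG.dim (range (\<lambda>x. e * x)) + KG.dim (range (\<lambda>x. (1 - e) * x))"
    using dim_idempotent_split[OF KG.subspace_UNIV _ e] by (simp add: dim_galg_UNIV del: KG.dim_UNIV)
  moreover have "card H * (KG.dim ((\<lambda>x. e * x) ` invs) + KG.dim ((\<lambda>x. (1 - e) * x) ` invs)) \<le> CARD('g)"
    using dim_idempotent_split[OF subspace_right_invariants mult_invariant e] dim_invs_le
    by (metis card_transversal_mult mult.commute mult_le_mono2)
  ultimately show ?thesis using le[OF e] le[OF e'] by (simp add: distrib_left)
qed

end

lemma idempotent_power:
  fixes e :: "'a::monoid_mult"
  assumes "e * e = e" "n > 0"
  shows "e ^ n = e"
  using assms(2) by (induction n rule: nat_induct_non_zero) (simp_all add: assms(1))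

text \<open>
  The arithmetic core: the dimension of \<open>e KG\<close> is divisible by the full \<open>p\<close>-part of \<open>|G|\<close>, and the
  coefficient of \<open>e\<close> at the neutral element is the image of \<open>dim (e KG) / |G|\<close> in the field. The
  cofactor \<open>r\<close> is the rank of \<open>e\<close> on the cosets of a Sylow \<open>p\<close>-subgroup, hence equals the coset trace
  of \<open>e\<close> in the field. Now \<open>e = e ^ (p ^ a)\<close>, so every trace function takes on \<open>e\<close> the value that it
  takes on the sum of the powers \<open>(e(g) g) ^ (p ^ a)\<close>. The group elements occurring there have order
  prime to \<open>p\<close>, so the coset trace agrees on them with \<open>m\<close> times the coefficient at the neutral
  element. As that coefficient is itself a trace function, the agreement carries over to \<open>e\<close>.
\<close>
lemma dim_idempotent_ideal:
  fixes e :: "'g::{group_add,finite} \<Rightarrow>\<^sub>0 'k::field"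
  assumes e: "e * e = e"
    and p: "prime p" and n: "CARD('g) = p ^ a * m" and m: "\<not> p dvd m"
    and char: "a > 0 \<Longrightarrow> of_nat p = (0::'k)"
  shows "\<exists>r. KG.dim (range (\<lambda>x. e * x)) = p ^ a * r \<and>
    of_nat r = of_nat m * Poly_Mapping.lookup e 0"
proof -
  obtain H :: "'g set" where H: "subgroup H plus_group" and card: "card H = p ^ a"
    using sylow_thm[OF p group_plus_group[where 'g = 'g], of a m] n by (auto simp: Coset.order_def)
  obtain R where R: "left_transversal R H" using exists_left_transversal[OF H] by blast
  interpret group_algebra_transversal H R "TYPE('k)" by (rule group_algebra_transversal.intro[OF H R])
  have p0: "p > 0" using p by (simp add: prime_gt_0_nat)
  have cardR: "card R = m" using card_transversal_mult card n p0 by simp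
  let ?q = "p ^ a"
  let ?c = "Poly_Mapping.lookup e"
  have eq: "(\<Sum>g\<in>UNIV. Poly_Mapping.single g (?c g)) ^ ?q = e"
    using idempotent_power[OF e, of ?q] p0 by (simp flip: poly_mapping_eq_sum_single)
  have "coset_trace e = (\<Sum>g\<in>UNIV. coset_trace (Poly_Mapping.single g (?c g) ^ ?q))"
    using trace_of_power_of_sum[where k = a and \<Lambda> = coset_trace and y = "\<lambda>g. Poly_Mapping.single g (?c g)",
        OF coset_trace_commute coset_trace_add coset_trace_zero p char] by (simp only: eq)
  also have "\<dots> = (\<Sum>g\<in>UNIV. of_nat m * Poly_Mapping.lookup (Poly_Mapping.single g (?c g) ^ ?q) 0)"
  proof (intro sum.cong refl)
    fix g :: 'g
    have "coset_trace (Poly_Mapping.single (g [^]\<^bsub>plus_group\<^esub> ?q) (?c g ^ ?q)) =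
        (if g [^]\<^bsub>plus_group\<^esub> ?q = 0 then of_nat (card R) * ?c g ^ ?q else 0)"
      by (rule coset_trace_single)
        (rule p_part_power_conjugate_in_p_subgroup_imp_zero[OF H p card n m])
    then show "coset_trace (Poly_Mapping.single g (?c g) ^ ?q) =
        of_nat m * Poly_Mapping.lookup (Poly_Mapping.single g (?c g) ^ ?q) 0"
      by (simp add: single_power cardR lookup_single when_def)
  qed
  also have "\<dots> = of_nat m * (\<Sum>g\<in>UNIV. Poly_Mapping.lookup (Poly_Mapping.single g (?c g) ^ ?q) 0)"
    by (simp only: sum_distrib_left)
  also have "(\<Sum>g\<in>UNIV. Poly_Mapping.lookup (Poly_Mapping.single g (?c g) ^ ?q) 0) =
      Poly_Mapping.lookup e 0"
  proof -
    have "Poly_Mapping.lookup (x * y) 0 = Poly_Mapping.lookup (y * x) 0"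
      for x y :: "'g \<Rightarrow>\<^sub>0 'k"
    proof -
      have "Poly_Mapping.lookup (x * y) 0 = (\<Sum>g\<in>UNIV. Poly_Mapping.lookup x g * Poly_Mapping.lookup y (- g))"
        by (simp add: lookup_mult_finite)
      also have "\<dots> = (\<Sum>g\<in>UNIV. Poly_Mapping.lookup y g * Poly_Mapping.lookup x (- g))"
        by (rule sum.reindex_bij_witness[of _ uminus uminus]) (auto simp: mult.commute)
      also have "\<dots> = Poly_Mapping.lookup (y * x) 0"
        by (simp add: lookup_mult_finite)
      finally show ?thesis .
    qed
    then show ?thesis
      using trace_of_power_of_sum[where k = a and \<Lambda> = "\<lambda>x. Poly_Mapping.lookup x 0" and
          y = "\<lambda>g. Poly_Mapping.single g (?c g)", OF _ _ _ p char]
      by (simp add: eq lookup_add)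
  qed
  finally have "of_nat (KG.dim ((\<lambda>x. e * x) ` invs)) = of_nat m * Poly_Mapping.lookup e 0"
    by (simp add: coset_trace_idempotent[OF e])
  then show ?thesis using dim_ideal_eq_card_mult_dim_invariants[OF e p card char] card by auto
qed

section \<open>The Mathieu property and idempotents\<close>

lemma in_V_G_iff: "x \<in> V_G \<longleftrightarrow> Poly_Mapping.lookup x 0 = 0"
  for x :: "'g::{group_add,finite} \<Rightarrow>\<^sub>0 'k::field"
proof
  assume "x \<in> V_G"
  then show "Poly_Mapping.lookup x 0 = 0" unfolding V_G_def
    by (induction rule: KG.span_induct_alt)
      (auto simp: lookup_add lookup_single when_def)
next
  assume x: "Poly_Mapping.lookup x 0 = 0"
  have "galg_scale (Poly_Mapping.lookup x g) (grp_elem g) \<in> V_G" for g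
  proof (cases "g = 0")
    case True
    then show ?thesis unfolding V_G_def by (simp add: x KG.span_zero)
  next
    case False
    then show ?thesis unfolding V_G_def by (intro KG.span_scale KG.span_base) blast
  qed
  then have "(\<Sum>g\<in>UNIV. galg_scale (Poly_Mapping.lookup x g) (grp_elem g)) \<in> V_G"
    unfolding V_G_def by (intro KG.span_sum)
  also have "(\<Sum>g\<in>UNIV. galg_scale (Poly_Mapping.lookup x g) (grp_elem g)) = x"
    using poly_mapping_eq_sum_single[of x] by (simp add: galg_scale_single)
  finally show "x \<in> V_G" .
qed

text \<open>
  This is Fitting's lemma for multiplication by \<open>b\<close>. The ideals \<open>b ^ m \<cdot> C\<close> of the commutative
  algebra \<open>C\<close> generated by \<open>b\<close> stabilise, so \<open>b ^ m = b ^ (2 m) x\<close> for some \<open>m\<close> and some \<open>x \<in> C\<close>,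
  and then \<open>b ^ m x\<close> is idempotent. For \<open>m \<ge> 1\<close> the ideal lies in the span of the positive powers of
  \<open>b\<close>, that is, in \<open>V\<close>.
\<close>
lemma exists_idempotent_if_not_nilpotent:
  fixes b :: "'g::{group_add,finite} \<Rightarrow>\<^sub>0 'k::field"
  assumes V: "KG.subspace V" and b: "\<And>m. m \<ge> 1 \<Longrightarrow> b ^ m \<in> V" and nonnil: "\<And>m. b ^ m \<noteq> 0"
  shows "\<exists>e\<in>V. e \<noteq> 0 \<and> e * e = e"
proof -
  define C where "C = KG.span (range (\<lambda>k. b ^ k))"
  define S where "S m = (\<lambda>x. b ^ m * x) ` C" for m
  have C: "KG.subspace C" by (simp add: C_def)
  have subS: "KG.subspace (S m)" for m unfolding S_def by (rule subspace_mult_image[OF C])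
  have indC: "P x" if "x \<in> C" "KG.subspace (Collect P)" "\<And>k. P (b ^ k)" for P x
    using KG.span_induct[of x "range (\<lambda>k. b ^ k)" P] that by (auto simp: C_def)
  have comm: "b ^ m * x = x * b ^ m" if "x \<in> C" for m x
    using that
    by (rule indC) (auto simp: KG.subspace_def distrib_left distrib_right galg_scale_mult_left
        galg_scale_mult_right add.commute simp flip: power_add)
  have closed: "b ^ m * x \<in> C" if "x \<in> C" for m x
    using that
  proof (rule indC)
    show "b ^ m * b ^ k \<in> C" for k
      unfolding power_add[symmetric] C_def by (rule KG.span_base) blast
    show "KG.subspace {x. b ^ m * x \<in> C}"
      using C by (auto simp: KG.subspace_def distrib_left galg_scale_mult_right)
  qed
  have SV: "S m \<subseteq> V" if "m \<ge> 1" for m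
  proof
    fix y assume "y \<in> S m"
    then obtain x where x: "x \<in> C" "y = b ^ m * x" by (auto simp: S_def)
    have "b ^ m * x \<in> V" using x(1)
    proof (rule indC)
      show "b ^ m * b ^ k \<in> V" for k
        unfolding power_add[symmetric] using that by (intro b) simp
      show "KG.subspace {x. b ^ m * x \<in> V}"
        using V by (auto simp: KG.subspace_def distrib_left galg_scale_mult_right)
    qed
    then show "y \<in> V" using x by simp
  qed
  \<comment> \<open>A minimal dimension over all positive exponents marks a point where the chain is stable.\<close>
  obtain m where m: "m \<ge> 1" and least: "\<And>k. k \<ge> 1 \<Longrightarrow> KG.dim (S m) \<le> KG.dim (S k)"
    using ex_has_least_nat[of "\<lambda>m::nat. m \<ge> 1" 1 "\<lambda>m. KG.dim (S m)"] by auto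
  have "S (m + m) \<subseteq> S m"
    using closed by (auto simp: S_def power_add mult.assoc)
  then have "S (m + m) = S m"
    using least[of "m + m"] m by (intro KG.subspace_dim_equal[OF subS subS]) auto
  moreover have "b ^ m \<in> S m"
  proof -
    have "1 \<in> C" unfolding C_def by (rule KG.span_base) (metis power_0 rangeI)
    then show ?thesis unfolding S_def by (intro image_eqI[of _ _ 1]) auto
  qed
  ultimately obtain x where x: "x \<in> C" "b ^ m = b ^ (m + m) * x" by (auto simp: S_def)
  define e where "e = b ^ m * x"
  have eb: "e * b ^ m = b ^ m"
  proof -
    have "e * b ^ m = b ^ m * (x * b ^ m)" by (simp add: e_def mult.assoc)
    also have "\<dots> = b ^ (m + m) * x" by (simp add: comm[OF x(1), symmetric] power_add mult.assoc)
    finally show ?thesis using x(2) by simp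
  qed
  have "e * e = (e * b ^ m) * x" by (simp add: e_def mult.assoc)
  then have "e * e = e" by (simp add: eb) (simp add: e_def)
  moreover have "e \<noteq> 0" using eb nonnil[of m] by auto
  moreover have "e \<in> V" using SV[OF m] x(1) by (auto simp: e_def S_def)
  ultimately show ?thesis by blast
qed

lemma ring_center_simps [simp, intro]:
  "0 \<in> ring_center" "1 \<in> ring_center"
  "x \<in> ring_center \<Longrightarrow> y \<in> ring_center \<Longrightarrow> x + y \<in> ring_center"
  "x \<in> ring_center \<Longrightarrow> y \<in> ring_center \<Longrightarrow> x - y \<in> ring_center"
  "x \<in> ring_center \<Longrightarrow> y \<in> ring_center \<Longrightarrow> x * y \<in> ring_center"
proof -
  assume xy: "x \<in> ring_center" "y \<in> ring_center"
  then have c: "x * z = z * x" "y * z = z * y" for z by (simp_all add: ring_center_def)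
  show "x + y \<in> ring_center" "x - y \<in> ring_center"
    using c by (simp_all add: ring_center_def algebra_simps)
  have "x * y * z = z * (x * y)" for z by (metis c mult.assoc)
  then show "x * y \<in> ring_center" by (simp add: ring_center_def)
qed (simp_all add: ring_center_def)

lemma ring_center_commute: "x \<in> ring_center \<Longrightarrow> x * y = y * x"
  by (simp add: ring_center_def)

lemma ring_center_sum: "(\<And>i. i \<in> A \<Longrightarrow> f i \<in> ring_center) \<Longrightarrow> sum f A \<in> ring_center"
  by (induction A rule: infinite_finite_induct) auto

lemma subspace_ring_center:
  "KG.subspace (ring_center :: ('g::{group_add,finite} \<Rightarrow>\<^sub>0 'k::field) set)"
  by (auto simp: KG.subspace_def ring_center_def galg_scale_mult_left galg_scale_mult_right
      distrib_left distrib_right)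

text \<open>
  If \<open>e\<close> is a nonzero idempotent in the subspace, the Mathieu property puts all \<open>g e\<close> into \<open>V_G\<close>,
  and the coefficient of \<open>g e\<close> at the neutral element is that of \<open>e\<close> at \<open>- g\<close>, which forces \<open>e = 0\<close>.
  Conversely, without such idempotents every \<open>b\<close> whose positive powers lie in the subspace is
  nilpotent, and the Mathieu condition becomes trivial.
\<close>
lemma mathieu_center_iff_no_traceless_idempotent:
  "mathieu_subspace galg_scale (V_G \<inter> ring_center :: ('g::{group_add,finite} \<Rightarrow>\<^sub>0 'k::field) set) \<longleftrightarrow>
    (\<forall>e\<in>ring_center :: ('g \<Rightarrow>\<^sub>0 'k) set. e * e = e \<and> e \<noteq> 0 \<longrightarrow> Poly_Mapping.lookup e 0 \<noteq> 0)"
    (is "mathieu_subspace _ ?V \<longleftrightarrow> ?R")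
proof
  assume M: "mathieu_subspace galg_scale ?V"
  show ?R
  proof (intro ballI impI notI)
    fix e :: "'g \<Rightarrow>\<^sub>0 'k"
    assume e: "e \<in> ring_center" "e * e = e \<and> e \<noteq> 0" "Poly_Mapping.lookup e 0 = 0"
    have pow: "e ^ m = e" if "m \<ge> 1" for m using idempotent_power[of e m] e(2) that by simp
    have "e \<in> ?V" using e by (simp add: in_V_G_iff)
    then have pV: "\<forall>m\<ge>1. e ^ m \<in> ?V" using pow by simp
    have "Poly_Mapping.lookup e g = 0" for g
    proof -
      obtain N where N: "\<forall>m\<ge>N. grp_elem (- g) * e ^ m * 1 \<in> ?V"
        using M pV unfolding mathieu_subspace_def by blast
      then have "grp_elem (- g) * e \<in> ?V" using pow[of "Suc N"] N[rule_format, of "Suc N"] by simp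
      then show ?thesis by (simp add: in_V_G_iff lookup_single_mult)
    qed
    then have "e = 0" by (intro poly_mapping_eqI) simp
    then show False using e(2) by simp
  qed
next
  assume R: ?R
  have sub: "KG.subspace ?V"
    unfolding V_G_def by (intro KG.subspace_inter KG.subspace_span subspace_ring_center)
  show "mathieu_subspace galg_scale ?V"
    unfolding mathieu_subspace_def
  proof (intro conjI sub allI impI)
    fix a b c :: "'g \<Rightarrow>\<^sub>0 'k"
    assume b: "\<forall>m\<ge>1. b ^ m \<in> ?V"
    obtain N where N: "b ^ N = 0"
    proof (rule ccontr)
      assume "\<not> thesis"
      then have "b ^ m \<noteq> 0" for m using that by blast
      then obtain e where "e \<in> ?V" "e \<noteq> 0" "e * e = e"
        using exists_idempotent_if_not_nilpotent[OF sub] b by blast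
      then show False using R by (auto simp: in_V_G_iff)
    qed
    have "b ^ m = 0" if "m \<ge> N" for m
      using N le_Suc_ex[OF that] by (auto simp: power_add)
    then show "\<exists>N. \<forall>m\<ge>N. a * b ^ m * c \<in> ?V"
      using KG.subspace_0[OF sub] by (intro exI[of _ N]) simp
  qed
qed

section \<open>Central idempotents and blocks\<close>

lemma primitive_central_idempotentD:
  assumes "primitive_central_idempotent f"
  shows "f \<in> ring_center" "f \<noteq> 0" "f * f = f"
  using assms by (simp_all add: primitive_central_idempotent_def)

text \<open>
  Primitivity is applied to the decomposition \<open>f = f e + (f - f e)\<close>.
\<close>
lemma primitive_central_idempotent_absorb:
  assumes f: "primitive_central_idempotent f" and e: "e \<in> ring_center" "e * e = e"
  shows "f * e = f \<or> f * e = 0"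
proof -
  note D = primitive_central_idempotentD[OF f]
  have fe: "f * e = e * f" using D(1) by (rule ring_center_commute)
  have sq: "f * e * (f * e) = f * e"
    by (metis D(3) e(2) fe mult.assoc)
  have e': "f * (1 - e) = f - f * e" by (simp add: right_diff_distrib)
  have ff: "f * (f * e) = f * e" using D(3) by (simp flip: mult.assoc)
  have fef: "f * e * f = f * e" by (simp only: mult.assoc fe[symmetric] ff)
  have "f * e \<in> ring_center" "f - f * e \<in> ring_center" using D(1) e(1) by auto
  moreover have "(f - f * e) * (f - f * e) = f - f * e" "f * e * (f - f * e) = 0"
    by (simp_all add: left_diff_distrib right_diff_distrib D(3) ff fef sq)
  moreover have "f = f * e + (f - f * e)" by simp
  ultimately have "f * e = 0 \<or> f - f * e = 0"
    using f sq unfolding primitive_central_idempotent_def by blast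
  then show ?thesis by auto
qed

lemma primitive_central_idempotents_orthogonal:
  assumes f: "primitive_central_idempotent f" and g: "primitive_central_idempotent g" and ne: "f \<noteq> g"
  shows "f * g = 0"
proof -
  note F = primitive_central_idempotentD[OF f] and G = primitive_central_idempotentD[OF g]
  have "f * g = g * f" by (rule ring_center_commute[OF F(1)])
  then show ?thesis
    using primitive_central_idempotent_absorb[OF f G(1,3)]
      primitive_central_idempotent_absorb[OF g F(1,3)] ne by auto
qed

text \<open>
  Splitting off a proper central summand strictly decreases the dimension of the ideal.
\<close>
lemma exists_primitive_central_idempotent_below:
  fixes e :: "'g::{group_add,finite} \<Rightarrow>\<^sub>0 'k::field"
  assumes "e \<in> ring_center" "e * e = e" "e \<noteq> 0"
  shows "\<exists>f. primitive_central_idempotent f \<and> e * f = f"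
  using assms
proof (induction "KG.dim (range (\<lambda>x. e * x))" arbitrary: e rule: less_induct)
  case less
  show ?case
  proof (cases "primitive_central_idempotent e")
    case True
    then show ?thesis using less.prems by blast
  next
    case False
    then obtain u v where uv: "u \<in> ring_center" "v \<in> ring_center" "u * u = u" "v * v = v"
      "u * v = 0" "e = u + v" "u \<noteq> 0" "v \<noteq> 0"
      using less.prems unfolding primitive_central_idempotent_def by blast
    have vu: "v * u = 0" using uv(5) ring_center_commute[OF uv(1), of v] by simp
    have eu: "e * u = u" and ev: "e * v = v" using uv vu by (simp_all add: distrib_right)
    have sub: "range (\<lambda>x. u * x) \<subseteq> range (\<lambda>x. e * x)"
    proof
      fix y assume "y \<in> range (\<lambda>x. u * x)"
      then obtain x where "y = u * x" by blast
      then have "y = e * (u * x)" using eu by (simp flip: mult.assoc)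
      then show "y \<in> range (\<lambda>x. e * x)" by blast
    qed
    have subsp: "KG.subspace (range (\<lambda>x. w * x))" for w :: "'g \<Rightarrow>\<^sub>0 'k"
      by (rule subspace_mult_image[OF KG.subspace_UNIV])
    have "v \<notin> range (\<lambda>x. u * x)"
    proof
      assume "v \<in> range (\<lambda>x. u * x)"
      then obtain x where "v = u * x" by blast
      then have "u * v = v" using uv(3) by (simp flip: mult.assoc)
      then show False using uv by simp
    qed
    moreover have "v \<in> range (\<lambda>x. e * x)" by (rule range_eqI[of _ _ v]) (simp add: ev)
    ultimately have "range (\<lambda>x. u * x) \<noteq> range (\<lambda>x. e * x)" by auto
    then have "KG.dim (range (\<lambda>x. u * x)) \<noteq> KG.dim (range (\<lambda>x. e * x))"
      using KG.subspace_dim_equal[OF subsp subsp sub] by auto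
    moreover have "KG.dim (range (\<lambda>x. u * x)) \<le> KG.dim (range (\<lambda>x. e * x))"
      by (rule KG.dim_subset[OF sub])
    ultimately have "KG.dim (range (\<lambda>x. u * x)) < KG.dim (range (\<lambda>x. e * x))" by simp
    then obtain f where f: "primitive_central_idempotent f" "u * f = f"
      using less.hyps[OF _ uv(1,3,7)] by blast
    have "e * f = e * u * f" using f(2) by (simp add: mult.assoc)
    then have "e * f = f" using eu f(2) by simp
    then show ?thesis using f(1) by blast
  qed
qed

lemma sum_primitive_central_idempotents:
  assumes Q: "finite Q" "Q \<subseteq> Collect primitive_central_idempotent"
  shows "\<Sum>Q \<in> ring_center"
    and "primitive_central_idempotent f \<Longrightarrow> \<Sum>Q * f = (if f \<in> Q then f else 0)"
    and "\<Sum>Q * \<Sum>Q = \<Sum>Q"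
proof -
  show "\<Sum>Q \<in> ring_center" by (rule ring_center_sum) (use primitive_central_idempotentD(1) Q(2) in blast)
  have *: "\<Sum>Q * f = (if f \<in> Q then f else 0)" if f: "primitive_central_idempotent f" for f
  proof -
    have "\<Sum>Q * f = (\<Sum>g\<in>Q. if g = f then f else 0)"
      unfolding sum_distrib_right
      by (intro sum.cong refl)
        (auto simp: primitive_central_idempotentD(3)[OF f]
          intro!: primitive_central_idempotents_orthogonal[OF _ f] dest: subsetD[OF Q(2)])
    then show ?thesis using Q(1) by simp
  qed
  then show "primitive_central_idempotent f \<Longrightarrow> \<Sum>Q * f = (if f \<in> Q then f else 0)" .
  have "\<Sum>Q * \<Sum>Q = (\<Sum>f\<in>Q. \<Sum>Q * f)" by (simp only: sum_distrib_left)
  also have "\<dots> = (\<Sum>f\<in>Q. f)" using Q(2) by (intro sum.cong refl) (auto simp: *)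
  finally show "\<Sum>Q * \<Sum>Q = \<Sum>Q" .
qed

text \<open>
  What is left of \<open>e\<close> after subtracting the primitive idempotents below it is again a central
  idempotent; a primitive idempotent below the remainder would also lie below \<open>e\<close> and hence would
  already have been subtracted.
\<close>
lemma central_idempotent_eq_sum_primitive:
  fixes e :: "'g::{group_add,finite} \<Rightarrow>\<^sub>0 'k::field"
  assumes fin: "finite {f :: 'g \<Rightarrow>\<^sub>0 'k. primitive_central_idempotent f}"
    and e: "e \<in> ring_center" "e * e = e"
  shows "e = \<Sum>{f. primitive_central_idempotent f \<and> e * f = f}"
proof (rule ccontr)
  let ?Q = "{f. primitive_central_idempotent f \<and> e * f = f}"
  have Q: "finite ?Q" "?Q \<subseteq> Collect primitive_central_idempotent"
    using fin by auto
  note S = sum_primitive_central_idempotents[OF Q]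
  assume "e \<noteq> \<Sum>?Q"
  define d where "d = e - \<Sum>?Q"
  have eS: "e * \<Sum>?Q = \<Sum>?Q" unfolding sum_distrib_left by (intro sum.cong) auto
  have Se: "\<Sum>?Q * e = \<Sum>?Q" using eS ring_center_commute[OF e(1)] by simp
  have "d \<in> ring_center" using e(1) S(1) by (simp add: d_def)
  moreover have "d * d = d"
    by (simp add: d_def left_diff_distrib right_diff_distrib e(2) eS Se S(3))
  moreover have "d \<noteq> 0" using \<open>e \<noteq> \<Sum>?Q\<close> by (simp add: d_def)
  ultimately obtain f where f: "primitive_central_idempotent f" "d * f = f"
    using exists_primitive_central_idempotent_below by blast
  have ed: "e * d = d" by (simp add: d_def right_diff_distrib e(2) eS)
  have "e * f = e * d * f" using f(2) by (simp add: mult.assoc)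
  then have "e * f = f" using ed f(2) by simp
  then have "d * f = 0" using S(2)[OF f(1)] f(1) by (simp add: d_def left_diff_distrib)
  then show False using f primitive_central_idempotentD(2) by auto
qed

text \<open>
  Thus a block determines its idempotent, and indexing the blocks amounts to indexing the primitive
  central idempotents.
\<close>
lemma primitive_central_idempotent_eqI:
  assumes f: "primitive_central_idempotent f" and g: "primitive_central_idempotent g"
    and eq: "range (\<lambda>x. f * x) = range (\<lambda>x. g * x)"
  shows "f = g"
proof (rule ccontr)
  assume "f \<noteq> g"
  then have "g * f = 0" using primitive_central_idempotents_orthogonal[OF g f] by simp
  have "f * f \<in> range (\<lambda>x. g * x)" unfolding eq[symmetric] by blast
  then obtain x where "f = g * x" using primitive_central_idempotentD(3)[OF f] by auto
  then have "g * f = f" using primitive_central_idempotentD(3)[OF g] by (simp flip: mult.assoc)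
  then show False using \<open>g * f = 0\<close> primitive_central_idempotentD(2)[OF f] by simp
qed

section \<open>The criterion in terms of block dimensions\<close>

text \<open>
  Here \<open>m\<close> will be the part of \<open>|G|\<close> prime to \<open>p\<close>; the denominator of the reduced fraction divides
  it and is therefore prime to \<open>p\<close>, too.
\<close>
lemma coprime_to_char_reduced_fraction:
  fixes r m p c :: nat
  assumes p: "prime p" and m: "\<not> p dvd m" and c: "c = 0 \<or> c = p"
    and q: "q = (of_nat r / of_nat m :: rat)"
  shows "coprime_to_char c (fst (quotient_of q)) \<and> coprime_to_char c (snd (quotient_of q)) \<longleftrightarrow> \<not> c dvd r"
proof -
  have m0: "m > 0" using m by (auto intro: Nat.gr0I)
  obtain x y where xy: "quotient_of q = (x, y)" by (cases "quotient_of q")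
  have y: "y > 0" and cop: "coprime x y"
    using quotient_of_denom_pos[OF xy] quotient_of_coprime[OF xy] by simp_all
  have "of_nat r / of_nat m = (of_int x / of_int y :: rat)" using quotient_of_div[OF xy] q by simp
  then have "of_int (x * int m) = (of_int (int r * y) :: rat)" using m0 y by (simp add: field_simps)
  then have eq: "x * int m = int r * y" by (simp only: of_int_eq_iff)
  show ?thesis
  proof (cases "c = 0")
    case True
    have "x = 0 \<longleftrightarrow> r = 0" using eq m0 y by auto
    then show ?thesis using True y by (simp add: coprime_to_char_def xy)
  next
    case False
    then have c: "c = p" using c by simp
    have P: "prime (int p)" using p by simp
    have p0: "p \<noteq> 0" using p by (metis not_prime_0)
    have ndvd: "coprime z (int p) \<longleftrightarrow> \<not> int p dvd z" for z
      using P by (metis coprime_commute not_prime_unit prime_imp_coprime coprime_absorb_left)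
    have "y dvd x * int m" using eq by simp
    then have "y dvd int m" using cop by (simp add: coprime_dvd_mult_right_iff coprime_commute)
    then have py: "\<not> int p dvd y" using m by (meson dvd_trans int_dvd_int_iff)
    have "int p dvd x \<longleftrightarrow> int p dvd x * int m" using P m by (simp add: prime_dvd_mult_iff)
    also have "\<dots> \<longleftrightarrow> p dvd r" unfolding eq using P py by (simp add: prime_dvd_mult_iff)
    finally show ?thesis using c p0 py by (simp add: coprime_to_char_def xy ndvd)
  qed
qed

theorem corollary1p10:
  fixes B :: "nat \<Rightarrow> ('g::{group_add,finite} \<Rightarrow>\<^sub>0 'k::field) set"
    and t :: nat and d :: "nat \<Rightarrow> nat"
  assumes "is_splitting_field TYPE('k) TYPE('g)"
    and "bij_betw B {1..t} blocks"
    and "\<And>i. i \<in> {1..t} \<Longrightarrow> d i = KG.dim (B i)"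
  shows "mathieu_subspace galg_scale (V_G \<inter> ring_center :: ('g \<Rightarrow>\<^sub>0 'k) set) \<longleftrightarrow>
    (\<forall>J. J \<noteq> {} \<and> J \<subseteq> {1..t} \<longrightarrow>
      (let q = (1 / of_nat CARD('g)) * (\<Sum>i\<in>J. of_nat (d i)) :: rat in
        coprime_to_char CHAR('k) (fst (quotient_of q)) \<and>
        coprime_to_char CHAR('k) (snd (quotient_of q))))"
proof -
  let ?P = "{f :: 'g \<Rightarrow>\<^sub>0 'k. primitive_central_idempotent f}"
  \<comment> \<open>In characteristic 0, take a prime not dividing \<open>|G|\<close>: then the Sylow subgroup is trivial and
    \<open>dim_idempotent_ideal\<close> says that the coefficient at 0 is \<open>dim / |G|\<close>.\<close>
  obtain p where p: "prime p" and cp: "CHAR('k) = 0 \<and> \<not> p dvd CARD('g) \<or> CHAR('k) = p"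
  proof (cases "CHAR('k) = 0")
    case True
    obtain p where "prime p" "p > CARD('g)" using bigger_prime by blast
    then have "\<not> p dvd CARD('g)" by (auto dest: dvd_imp_le)
    then show ?thesis using that True \<open>prime p\<close> by blast
  next
    case False
    then show ?thesis using that[of "CHAR('k)"] prime_CHAR_semidom[where 'a = 'k] by simp
  qed
  define a where "a = multiplicity p CARD('g)"
  have "CARD('g) \<noteq> 0" "\<not> is_unit p" using p by auto
  then obtain m where n: "CARD('g) = p ^ a * m" and m: "\<not> p dvd m"
    unfolding a_def by (rule multiplicity_decompose')
  have char: "of_nat p = (0::'k)" if "a > 0"
  proof -
    have "p dvd CARD('g)" unfolding n using that by (simp add: dvd_power)
    then have "CHAR('k) = p" using cp by blast
    then show ?thesis using of_nat_CHAR[where 'a = 'k] by simp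
  qed
  have mK: "of_nat m \<noteq> (0::'k)"
  proof
    assume "of_nat m = (0::'k)"
    then have "CHAR('k) dvd m" by (simp only: of_nat_eq_0_iff_char_dvd)
    then show False using cp m by (elim disjE conjE) auto
  qed
  have "\<exists>f. primitive_central_idempotent f \<and> B i = range (\<lambda>x. f * x)" if "i \<in> {1..t}" for i
    using bij_betwE[OF assms(2)] that unfolding blocks_def by blast
  then have "\<forall>i\<in>{1..t}. \<exists>f. primitive_central_idempotent f \<and> B i = range (\<lambda>x. f * x)" by blast
  from bchoice[OF this] obtain F where F: "\<And>i. i \<in> {1..t} \<Longrightarrow> primitive_central_idempotent (F i)"
    and BF: "\<And>i. i \<in> {1..t} \<Longrightarrow> B i = range (\<lambda>x. F i * x)" by blast
  have injF: "inj_on F {1..t}"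
  proof (rule inj_onI)
    fix i j assume ij: "i \<in> {1..t}" "j \<in> {1..t}" "F i = F j"
    then have "B i = B j" using BF by simp
    then show "i = j" using inj_onD[OF bij_betw_imp_inj_on[OF assms(2)]] ij by blast
  qed
  have surjF: "F ` {1..t} = ?P"
  proof (intro equalityI subsetI)
    fix f assume f: "f \<in> ?P"
    then have "range (\<lambda>x. f * x) \<in> blocks" by (auto simp: blocks_def)
    then have "range (\<lambda>x. f * x) \<in> B ` {1..t}"
      unfolding bij_betw_imp_surj_on[OF assms(2)] .
    then obtain i where i: "range (\<lambda>x. f * x) = B i" "i \<in> {1..t}" by (rule imageE)
    then have "f = F i"
      using f F[OF i(2)] i(1) BF[OF i(2)] by (intro primitive_central_idempotent_eqI) simp_all
    then show "f \<in> F ` {1..t}" using i by blast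
  qed (use F in auto)
  then have finP: "finite ?P" using finite_imageI[of "{1..t}" F] by simp
  have "\<forall>i\<in>{1..t}. \<exists>r. d i = p ^ a * r \<and> of_nat r = (of_nat m :: 'k) * Poly_Mapping.lookup (F i) 0"
  proof
    fix i assume i: "i \<in> {1..t}"
    show "\<exists>r. d i = p ^ a * r \<and> of_nat r = (of_nat m :: 'k) * Poly_Mapping.lookup (F i) 0"
      unfolding assms(3)[OF i] BF[OF i]
      by (rule dim_idempotent_ideal[OF _ p n m char])
        (rule primitive_central_idempotentD(3)[OF F[OF i]])
  qed
  from bchoice[OF this] obtain r where dr: "\<And>i. i \<in> {1..t} \<Longrightarrow> d i = p ^ a * r i"
    and r: "\<And>i. i \<in> {1..t} \<Longrightarrow> of_nat (r i) = (of_nat m :: 'k) * Poly_Mapping.lookup (F i) 0"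
    by blast
  have crit: "(let q = (1 / of_nat CARD('g)) * (\<Sum>i\<in>J. of_nat (d i)) :: rat in
        coprime_to_char CHAR('k) (fst (quotient_of q)) \<and>
        coprime_to_char CHAR('k) (snd (quotient_of q))) \<longleftrightarrow>
      Poly_Mapping.lookup (\<Sum>i\<in>J. F i) 0 \<noteq> 0" if J: "J \<subseteq> {1..t}" for J
  proof -
    have "(\<Sum>i\<in>J. of_nat (d i)) = (of_nat (p ^ a) * of_nat (\<Sum>i\<in>J. r i) :: rat)"
      unfolding of_nat_sum sum_distrib_left using J dr by (intro sum.cong refl) (auto simp: subset_iff)
    then have frac: "(1 / of_nat CARD('g)) * (\<Sum>i\<in>J. of_nat (d i)) =
        (of_nat (\<Sum>i\<in>J. r i) / of_nat m :: rat)"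
      using prime_gt_0_nat[OF p] unfolding n by simp
    have "(let q = (1 / of_nat CARD('g)) * (\<Sum>i\<in>J. of_nat (d i)) :: rat in
        coprime_to_char CHAR('k) (fst (quotient_of q)) \<and>
        coprime_to_char CHAR('k) (snd (quotient_of q))) \<longleftrightarrow> \<not> CHAR('k) dvd (\<Sum>i\<in>J. r i)"
      unfolding Let_def by (rule coprime_to_char_reduced_fraction[OF p m _ frac]) (use cp in blast)
    also have "\<dots> \<longleftrightarrow> of_nat (\<Sum>i\<in>J. r i) \<noteq> (0::'k)" by (simp only: of_nat_eq_0_iff_char_dvd)
    also have "of_nat (\<Sum>i\<in>J. r i) = (of_nat m :: 'k) * Poly_Mapping.lookup (\<Sum>i\<in>J. F i) 0"
      unfolding of_nat_sum lookup_sum sum_distrib_left using J r by (intro sum.cong) auto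
    finally show ?thesis using mK by simp
  qed
  have "mathieu_subspace galg_scale (V_G \<inter> ring_center :: ('g \<Rightarrow>\<^sub>0 'k) set) \<longleftrightarrow>
      (\<forall>J. J \<noteq> {} \<and> J \<subseteq> {1..t} \<longrightarrow> Poly_Mapping.lookup (\<Sum>i\<in>J. F i) 0 \<noteq> 0)"
    unfolding mathieu_center_iff_no_traceless_idempotent
  proof (intro iffI allI impI ballI)
    fix J assume *: "\<forall>e\<in>ring_center :: ('g \<Rightarrow>\<^sub>0 'k) set. e * e = e \<and> e \<noteq> 0 \<longrightarrow> Poly_Mapping.lookup e 0 \<noteq> 0"
      and J: "J \<noteq> {} \<and> J \<subseteq> {1..t}"
    have sumF: "(\<Sum>i\<in>J. F i) = \<Sum>(F ` J)"
      using J injF by (subst sum.reindex) (auto intro: inj_on_subset)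
    have "finite (F ` J)" "F ` J \<subseteq> Collect primitive_central_idempotent"
      using J F finite_subset[of J "{1..t}"] by auto
    note S = sum_primitive_central_idempotents[OF this]
    obtain i where i: "i \<in> J" using J by blast
    have Fi: "primitive_central_idempotent (F i)" using F i J by blast
    then have "\<Sum>(F ` J) * F i = F i" using S(2)[OF Fi] i by simp
    then have "\<Sum>(F ` J) \<noteq> 0" using primitive_central_idempotentD(2)[OF Fi] by auto
    then show "Poly_Mapping.lookup (\<Sum>i\<in>J. F i) 0 \<noteq> 0" unfolding sumF using * S(1,3) by blast
  next
    fix e :: "'g \<Rightarrow>\<^sub>0 'k"
    assume *: "\<forall>J. J \<noteq> {} \<and> J \<subseteq> {1..t} \<longrightarrow> Poly_Mapping.lookup (\<Sum>i\<in>J. F i) 0 \<noteq> 0"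
      and e: "e \<in> ring_center" "e * e = e \<and> e \<noteq> 0"
    define J where "J = {i \<in> {1..t}. e * F i = F i}"
    have "F ` J = {f. primitive_central_idempotent f \<and> e * f = f}"
    proof (intro equalityI subsetI)
      fix f assume f: "f \<in> {f. primitive_central_idempotent f \<and> e * f = f}"
      then have "f \<in> F ` {1..t}" unfolding surjF by blast
      then obtain i where "i \<in> {1..t}" "f = F i" by blast
      then show "f \<in> F ` J" using f by (auto simp: J_def)
    qed (use F in \<open>auto simp: J_def\<close>)
    then have "e = \<Sum>(F ` J)"
      using central_idempotent_eq_sum_primitive[OF finP e(1)] e(2) by simp
    also have "\<dots> = (\<Sum>i\<in>J. F i)"
      using injF by (subst sum.reindex) (auto simp: J_def intro: inj_on_subset)
    finally have eJ: "e = (\<Sum>i\<in>J. F i)" .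
    have "J \<noteq> {}"
    proof
      assume "J = {}"
      then have "e = 0" using eJ by simp
      then show False using e(2) by simp
    qed
    moreover have "J \<subseteq> {1..t}" by (auto simp: J_def)
    ultimately show "Poly_Mapping.lookup e 0 \<noteq> 0" unfolding eJ using *[rule_format, of J] by simp
  qed
  also have "\<dots> \<longleftrightarrow> (\<forall>J. J \<noteq> {} \<and> J \<subseteq> {1..t} \<longrightarrow>
      (let q = (1 / of_nat CARD('g)) * (\<Sum>i\<in>J. of_nat (d i)) :: rat in
        coprime_to_char CHAR('k) (fst (quotient_of q)) \<and>
        coprime_to_char CHAR('k) (snd (quotient_of q))))"
    by (intro iff_allI imp_cong refl crit[symmetric]) blast
  finally show ?thesis .
qed

end
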